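(* Let $f\colon\Sigma\to\mathbb{R}^3$ be a front, $\nu\colon\Sigma\to S^2$ its Gauss map, $p\in\Sigma$ a cuspidal edge of $f$ and $\gamma(t)$ ($|t|<\varepsilon$) the singular curve of $f$ passing through $p=\gamma(0)$. Take the orientation of $\gamma$ so that the left-hand side of $\gamma$ is the region $\lambda>0$ on a neighborhood $U\subset\Sigma$ of $p$, where $\lambda$ is the signed area density function of $f$. Suppose that the Gaussian curvature $K$ of $f$ is non-zero and bounded on $U$ and that $\nu$ has a cusp at $p$. Take the parabolic curve $\sigma(t)$ through $p=\sigma(0)$ to be $\sigma(t)=\gamma(t)$. Then $p$ is a positive (resp. negative) cusp of the singular locus $\check{\nu}=\nu\circ\sigma$ of $\nu$ if and only if the singular curvature $\kappa_s$ of $f$ is positive (resp. negative) at $p$.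
   Context: **Setting.** $\Sigma\subset\mathbb{R}^2$ is a domain, all maps are $C^\infty$, $\langle\cdot,\cdot\rangle$ is the Euclidean inner product of $\mathbb{R}^3$ and $S^2\subset\mathbb{R}^3$ is the unit sphere. Two map germs are $\mathcal{A}$-equivalent if they coincide up to diffeomorphism germs on the source and on the target. **Fronts and cuspidal edges.** A $C^\infty$ map $f\colon\Sigma\to\mathbb{R}^3$ is a front if there is a $C^\infty$ map $\nu\colon\Sigma\to S^2$ (the Gauss map of $f$) such that $\langle df_q(X),\nu(q)\rangle=0$ for all $q\in\Sigma$, $X\in T_q\Sigma$, and $(f,\nu)\colon\Sigma\to\mathbb{R}^3\times S^2$ is an immersion. The singular set is $S(f)=\{q\in\Sigma : \operatorname{rank} df_q<2\}$. A point $p\in S(f)$ is a cuspidal edge if the germ of $f$ at $p$ is $\mathcal{A}$-equivalent to $(u,v)\mapsto(u,v^2,v^3)$ at the origin. Near a cuspidal edge, $S(f)$ is the image of a regular curve $\gamma$ (the singular curve), consisting of cuspidal edges, and there is a null vector field, i.e. a nowhere zero vector field $\eta$ near $p$ with $df_q(\eta_q)=0$ for $q\in S(f)$. **Adapted coordinates and singular curvature.** The signed area density function is $\lambda=\det(f_u,f_v,\nu)$ (for positively oriented coordinates $(u,v)$ of $\Sigma$). Coordinates $(u,v)$ centered at the cuspidal edge $p$ are adapted if they are compatible with the orientation of $\Sigma$, the $u$-axis is the singular curve ($\gamma(u)=(u,0)$) and contains all singular points of $f$ in the chart, and $\partial_v$ is a null vector field. In adapted coordinates the singular curvature is, along the $u$-axis,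 $$\kappa_s=\operatorname{sgn}(\lambda_v)\frac{\det(f_u,f_{uu},\nu)}{|f_u|^3}.$$ **Gaussian curvature.** $K$ is the Gaussian curvature on the regular set $\Sigma\setminus S(f)$. If $K$ is bounded near a cuspidal edge, it extends to a $C^\infty$ function near it, and "non-zero" refers to this extension. When $K$ is non-zero and bounded near $p$, the singular set $S(\nu)$ of $\nu$ coincides with $S(f)$ near $p$. A regular curve $\sigma$ parametrizing $S(\nu)$ near $p$ is called a parabolic curve of $f$; thus it may be taken as $\sigma(t)=\gamma(\pm t)$. **Cusps.** The map $\nu$ has a cusp at $p$ if its germ at $p$ (as a map between 2-manifolds) is $\mathcal{A}$-equivalent to $(u,v)\mapsto(u,v^3+uv)$ at the origin. Then $\check\nu=\nu\circ\sigma$ is a spherical curve with an ordinary cusp at $t=0$, i.e. its germ there is $\mathcal{A}$-equivalent to $t\mapsto(t^2,t^3)$. For a curve $c\colon I\to S^2$ with an ordinary cusp at $t_0$, the cuspidal curvature is $$\mu=\left.\frac{\det(c,D_t\dot c,D_tD_t\dot c)}{|D_t\dot c|^{5/2}}\right|_{t=t_0},$$ where $D_t$ is the covariant derivative of $S^2$ along $c$ (tangential projection of $d/dt$). With $\gamma$ oriented so that $\lambda>0$ on its left-hand side and with $\sigma(t)=\gamma(t)$, the point $p$ is called a positive (resp. negative) cusp of $\check\nu$ if the cuspidal curvature $\mu^\nu$ of $\check\nu$ at $t=0$ is positive (resp. negative). *)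

theory Defs
  imports "HOL-Analysis.Analysis"
begin

section \<open>Smooth maps, diffeomorphisms and equivalence of germs\<close>

text \<open>\<open>Ck_on n S f\<close> is only meant for open \<open>S\<close>.\<close>

primrec Ck_on :: "nat \<Rightarrow> 'a::real_normed_vector set \<Rightarrow> ('a \<Rightarrow> 'b::real_normed_vector) \<Rightarrow> bool" where
  "Ck_on 0 S f \<longleftrightarrow> continuous_on S f"
| "Ck_on (Suc n) S f \<longleftrightarrow>
     (\<forall>x\<in>S. f differentiable (at x)) \<and> (\<forall>v. Ck_on n S (\<lambda>x. frechet_derivative f (at x) v))"

text \<open>Smoothness on an arbitrary subset of a Euclidean space means having local smooth extensions
  to open sets of the ambient space. On an open set this is the usual notion (lemma
  \<open>smooth_on_open_iff\<close> below); on the unit sphere it is the smoothness of the submanifold.\<close>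

definition smooth_on :: "'a::euclidean_space set \<Rightarrow> ('a \<Rightarrow> 'b::euclidean_space) \<Rightarrow> bool" where
  "smooth_on A f \<longleftrightarrow>
     (\<forall>x\<in>A. \<exists>U F. open U \<and> x \<in> U \<and> (\<forall>n. Ck_on n U F) \<and> (\<forall>y\<in>U \<inter> A. F y = f y))"

lemma Ck_on_cong:
  assumes "open S" "\<And>x. x \<in> S \<Longrightarrow> f x = g x"
  shows "Ck_on n S f \<longleftrightarrow> Ck_on n S g"
  using assms(2)
proof (induction n arbitrary: f g)
  case 0
  then show ?case by (auto cong: continuous_on_cong)
next
  case (Suc n)
  have d: "f differentiable (at x) \<longleftrightarrow> g differentiable (at x)" if "x \<in> S" for x
    using has_derivative_transform_within_open[OF _ assms(1) that] Suc.prems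
    unfolding differentiable_def by metis
  have e: "frechet_derivative f (at x) = frechet_derivative g (at x)"
    if "x \<in> S" "f differentiable (at x)" for x
    using frechet_derivative_transform_within_open[OF that(2) assms(1) that(1)] Suc.prems by blast
  show ?case
    using d e Suc.IH[of "\<lambda>x. frechet_derivative f (at x) v" "\<lambda>x. frechet_derivative g (at x) v" for v]
    by auto
qed

lemma Ck_on_subset: "Ck_on n S f \<Longrightarrow> T \<subseteq> S \<Longrightarrow> Ck_on n T f"
  by (induction n arbitrary: f) (auto intro: continuous_on_subset)

lemma Ck_on_local:
  assumes "\<And>x. x \<in> S \<Longrightarrow> \<exists>U. open U \<and> x \<in> U \<and> Ck_on n U f"
  shows "Ck_on n S f"
  using assms
proof (induction n arbitrary: f)
  case 0
  have "isCont f x" if "x \<in> S" for x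
    using 0[OF that] by (auto simp: continuous_on_eq_continuous_at)
  then show ?case by (simp add: continuous_at_imp_continuous_on)
next
  case (Suc n)
  have "Ck_on n S (\<lambda>x. frechet_derivative f (at x) v)" for v
    using Suc.prems by (intro Suc.IH) (auto, blast)
  moreover have "f differentiable (at x)" if "x \<in> S" for x
    using Suc.prems[OF that] by auto
  ultimately show ?case by simp
qed

lemma smooth_on_open_iff:
  assumes "open S"
  shows "smooth_on S f \<longleftrightarrow> (\<forall>n. Ck_on n S f)"
proof
  assume s: "smooth_on S f"
  show "\<forall>n. Ck_on n S f"
  proof (intro allI Ck_on_local)
    fix n x assume "x \<in> S"
    with s obtain U F where U: "open U" "x \<in> U" "Ck_on n U F" "\<forall>y\<in>U \<inter> S. F y = f y"
      unfolding smooth_on_def by blast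
    have o: "open (U \<inter> S)" using U(1) assms by blast
    have "Ck_on n (U \<inter> S) F" using U(3) Ck_on_subset by blast
    then have "Ck_on n (U \<inter> S) f" using Ck_on_cong[OF o] U(4) by blast
    with o U(2) \<open>x \<in> S\<close> show "\<exists>U. open U \<and> x \<in> U \<and> Ck_on n U f" by blast
  qed
next
  assume "\<forall>n. Ck_on n S f"
  with assms show "smooth_on S f" unfolding smooth_on_def by blast
qed

definition diffeo_between :: "'a::euclidean_space set \<Rightarrow> 'b::euclidean_space set \<Rightarrow> ('a \<Rightarrow> 'b) \<Rightarrow> bool" where
  "diffeo_between A B \<phi> \<longleftrightarrow> (\<exists>\<psi>. homeomorphism A B \<phi> \<psi> \<and> smooth_on A \<phi> \<and> smooth_on B \<psi>)"

text \<open>\<open>A_equivalent M N f p M' N' g p'\<close>: the germ of \<open>f: M \<rightarrow> N\<close> at \<open>p\<close> and the germ of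
  \<open>g: M' \<rightarrow> N'\<close> at \<open>p'\<close> coincide up to diffeomorphism germs on the source and on the target.
  The neighbourhoods are relatively open, so that the target may be the unit sphere.\<close>

definition A_equivalent ::
  "'a::euclidean_space set \<Rightarrow> 'b::euclidean_space set \<Rightarrow> ('a \<Rightarrow> 'b) \<Rightarrow> 'a \<Rightarrow>
   'c::euclidean_space set \<Rightarrow> 'd::euclidean_space set \<Rightarrow> ('c \<Rightarrow> 'd) \<Rightarrow> 'c \<Rightarrow> bool" where
  "A_equivalent M N f p M' N' g p' \<longleftrightarrow>
     (\<exists>U V W Z \<phi> \<Phi>.
        openin (top_of_set M) U \<and> p \<in> U \<and> openin (top_of_set M') V \<and> p' \<in> V \<and>
        openin (top_of_set N) W \<and> openin (top_of_set N') Z \<and>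
        f ` U \<subseteq> W \<and> g ` V \<subseteq> Z \<and>
        diffeo_between U V \<phi> \<and> \<phi> p = p' \<and> diffeo_between W Z \<Phi> \<and>
        (\<forall>q\<in>U. \<Phi> (f q) = g (\<phi> q)))"


section \<open>Fronts and cuspidal edges\<close>

abbreviation S2 :: "(real^3) set" where
  "S2 \<equiv> sphere 0 1"

definition det3 :: "real^3 \<Rightarrow> real^3 \<Rightarrow> real^3 \<Rightarrow> real" where
  "det3 a b c = det (vector [a, b, c] :: real^3^3)"

definition pd :: "2 \<Rightarrow> (real^2 \<Rightarrow> 'b::real_normed_vector) \<Rightarrow> real^2 \<Rightarrow> 'b" where
  "pd i f q = frechet_derivative f (at q) (axis i 1)"

definition immersion_on :: "'a::euclidean_space set \<Rightarrow> ('a \<Rightarrow> 'b::euclidean_space) \<Rightarrow> bool" where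
  "immersion_on S F \<longleftrightarrow> smooth_on S F \<and> (\<forall>q\<in>S. inj (frechet_derivative F (at q)))"

definition is_gauss_map :: "(real^2) set \<Rightarrow> (real^2 \<Rightarrow> real^3) \<Rightarrow> (real^2 \<Rightarrow> real^3) \<Rightarrow> bool" where
  "is_gauss_map \<Sigma> f \<nu> \<longleftrightarrow>
     smooth_on \<Sigma> \<nu> \<and> \<nu> ` \<Sigma> \<subseteq> S2 \<and>
     (\<forall>q\<in>\<Sigma>. \<forall>X. frechet_derivative f (at q) X \<bullet> \<nu> q = 0) \<and>
     immersion_on \<Sigma> (\<lambda>q. (f q, \<nu> q))"

definition front :: "(real^2) set \<Rightarrow> (real^2 \<Rightarrow> real^3) \<Rightarrow> bool" where
  "front \<Sigma> f \<longleftrightarrow> smooth_on \<Sigma> f \<and> (\<exists>\<nu>. is_gauss_map \<Sigma> f \<nu>)"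

definition singular_set :: "(real^2) set \<Rightarrow> (real^2 \<Rightarrow> real^3) \<Rightarrow> (real^2) set" where
  "singular_set \<Sigma> f = {q \<in> \<Sigma>. rank (jacobian f (at q)) < 2}"

definition cuspidal_edge :: "(real^2) set \<Rightarrow> (real^2 \<Rightarrow> real^3) \<Rightarrow> real^2 \<Rightarrow> bool" where
  "cuspidal_edge \<Sigma> f p \<longleftrightarrow> p \<in> singular_set \<Sigma> f \<and>
     A_equivalent \<Sigma> UNIV f p UNIV UNIV (\<lambda>w::real^2. vector [w$1, (w$2)^2, (w$2)^3] :: real^3) 0"

definition singular_curve ::
  "(real^2) set \<Rightarrow> (real^2 \<Rightarrow> real^3) \<Rightarrow> real^2 \<Rightarrow> real \<Rightarrow> (real \<Rightarrow> real^2) \<Rightarrow> bool" where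
  "singular_curve \<Sigma> f p \<epsilon> \<gamma> \<longleftrightarrow>
     0 < \<epsilon> \<and> smooth_on {-\<epsilon><..<\<epsilon>} \<gamma> \<and> \<gamma> 0 = p \<and>
     (\<forall>t\<in>{-\<epsilon><..<\<epsilon>}. vector_derivative \<gamma> (at t) \<noteq> 0 \<and> cuspidal_edge \<Sigma> f (\<gamma> t)) \<and>
     (\<exists>W. open W \<and> p \<in> W \<and> singular_set \<Sigma> f \<inter> W \<subseteq> \<gamma> ` {-\<epsilon><..<\<epsilon>})"


section \<open>Singular curvature and Gaussian curvature\<close>

definition area_density :: "(real^2 \<Rightarrow> real^3) \<Rightarrow> (real^2 \<Rightarrow> real^3) \<Rightarrow> real^2 \<Rightarrow> real" where
  "area_density f \<nu> q = det3 (pd 1 f q) (pd 2 f q) (\<nu> q)"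

text \<open>\<open>\<Sigma>\<close> carries the standard orientation of the plane, so the left-hand side of a regular curve is
  the side into which its velocity rotated by \<open>+\<pi>/2\<close> points.\<close>

definition rot90 :: "real^2 \<Rightarrow> real^2" where
  "rot90 v = vector [- v$2, v$1]"

definition positive_on_left ::
  "(real^2) set \<Rightarrow> real \<Rightarrow> (real \<Rightarrow> real^2) \<Rightarrow> (real^2 \<Rightarrow> real) \<Rightarrow> bool" where
  "positive_on_left U \<epsilon> \<gamma> h \<longleftrightarrow>
     (\<forall>t\<in>{-\<epsilon><..<\<epsilon>}. \<gamma> t \<in> U \<longrightarrow>
        (\<forall>\<^sub>F s in at_right 0. h (\<gamma> t + s *\<^sub>R rot90 (vector_derivative \<gamma> (at t))) > 0))"

text \<open>An adapted coordinate system is given by its inverse chart \<open>x\<close>, defined on an open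
  neighbourhood \<open>V\<close> of the origin of the \<open>(u,v)\<close>-plane.\<close>

definition adapted_coordinates ::
  "(real^2) set \<Rightarrow> (real^2 \<Rightarrow> real^3) \<Rightarrow> real^2 \<Rightarrow> (real^2) set \<Rightarrow> (real^2 \<Rightarrow> real^2) \<Rightarrow> bool" where
  "adapted_coordinates \<Sigma> f p V x \<longleftrightarrow>
     open V \<and> 0 \<in> V \<and> x 0 = p \<and> open (x ` V) \<and> x ` V \<subseteq> \<Sigma> \<and> diffeo_between V (x ` V) x \<and>
     (\<forall>w\<in>V. det (jacobian x (at w)) > 0) \<and>
     (\<forall>w\<in>V. x w \<in> singular_set \<Sigma> f \<longleftrightarrow> w$2 = 0) \<and>
     (\<forall>w\<in>V. w$2 = 0 \<longrightarrow> pd 2 (f \<circ> x) w = 0)"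

definition singular_curvature_in ::
  "(real^2 \<Rightarrow> real^3) \<Rightarrow> (real^2 \<Rightarrow> real^3) \<Rightarrow> (real^2 \<Rightarrow> real^2) \<Rightarrow> real" where
  "singular_curvature_in f \<nu> x =
     (let F = f \<circ> x; N = \<nu> \<circ> x in
      sgn (pd 2 (area_density F N) 0) * det3 (pd 1 F 0) (pd 1 (pd 1 F) 0) (N 0) / norm (pd 1 F 0) ^ 3)"

text \<open>At a cuspidal edge adapted coordinates exist and the value does not depend on their choice.\<close>

definition singular_curvature ::
  "(real^2) set \<Rightarrow> (real^2 \<Rightarrow> real^3) \<Rightarrow> (real^2 \<Rightarrow> real^3) \<Rightarrow> real^2 \<Rightarrow> real" where
  "singular_curvature \<Sigma> f \<nu> p =
     singular_curvature_in f \<nu> (SOME x. \<exists>V. adapted_coordinates \<Sigma> f p V x)"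

definition gaussian_curvature ::
  "(real^2 \<Rightarrow> real^3) \<Rightarrow> (real^2 \<Rightarrow> real^3) \<Rightarrow> real^2 \<Rightarrow> real" where
  "gaussian_curvature f \<nu> q =
     ((pd 1 (pd 1 f) q \<bullet> \<nu> q) * (pd 2 (pd 2 f) q \<bullet> \<nu> q) - (pd 2 (pd 1 f) q \<bullet> \<nu> q)^2) /
     ((pd 1 f q \<bullet> pd 1 f q) * (pd 2 f q \<bullet> pd 2 f q) - (pd 1 f q \<bullet> pd 2 f q)^2)"

text \<open>The extension of the Gaussian curvature to the singular set, by limits along the regular set.
  Where the curvature extends smoothly, this is the (unique) smooth extension.\<close>

definition extended_gaussian_curvature ::
  "(real^2) set \<Rightarrow> (real^2 \<Rightarrow> real^3) \<Rightarrow> (real^2 \<Rightarrow> real^3) \<Rightarrow> real^2 \<Rightarrow> real" where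
  "extended_gaussian_curvature \<Sigma> f \<nu> q =
     (if q \<in> singular_set \<Sigma> f
      then Lim (at q within \<Sigma> - singular_set \<Sigma> f) (gaussian_curvature f \<nu>)
      else gaussian_curvature f \<nu> q)"


section \<open>Cusps\<close>

definition gauss_map_cusp :: "(real^2) set \<Rightarrow> (real^2 \<Rightarrow> real^3) \<Rightarrow> real^2 \<Rightarrow> bool" where
  "gauss_map_cusp \<Sigma> \<nu> p \<longleftrightarrow>
     A_equivalent \<Sigma> S2 \<nu> p UNIV UNIV (\<lambda>w::real^2. vector [w$1, (w$2)^3 + w$1 * w$2] :: real^2) 0"

definition ordinary_cusp :: "real set \<Rightarrow> (real \<Rightarrow> real^3) \<Rightarrow> real \<Rightarrow> bool" where
  "ordinary_cusp I c t\<^sub>0 \<longleftrightarrow>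
     A_equivalent I S2 c t\<^sub>0 UNIV UNIV (\<lambda>t::real. vector [t^2, t^3] :: real^2) 0"

text \<open>Covariant derivative of the sphere along \<open>c\<close> of a vector field \<open>X\<close> along \<open>c\<close>: the projection of
  \<open>X'(t)\<close> to the tangent plane, which is the orthogonal complement of \<open>c(t)\<close>.\<close>

definition cov_deriv :: "(real \<Rightarrow> real^3) \<Rightarrow> (real \<Rightarrow> real^3) \<Rightarrow> real \<Rightarrow> real^3" where
  "cov_deriv c X t =
     vector_derivative X (at t) - (vector_derivative X (at t) \<bullet> c t) *\<^sub>R c t"

definition cuspidal_curvature :: "(real \<Rightarrow> real^3) \<Rightarrow> real \<Rightarrow> real" where
  "cuspidal_curvature c t\<^sub>0 =
     (let a = cov_deriv c (\<lambda>t. vector_derivative c (at t)) in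
      det3 (c t\<^sub>0) (a t\<^sub>0) (cov_deriv c a t\<^sub>0) / norm (a t\<^sub>0) powr (5/2))"

definition positive_cusp :: "real set \<Rightarrow> (real \<Rightarrow> real^3) \<Rightarrow> real \<Rightarrow> bool" where
  "positive_cusp I c t\<^sub>0 \<longleftrightarrow> ordinary_cusp I c t\<^sub>0 \<and> cuspidal_curvature c t\<^sub>0 > 0"

definition negative_cusp :: "real set \<Rightarrow> (real \<Rightarrow> real^3) \<Rightarrow> real \<Rightarrow> bool" where
  "negative_cusp I c t\<^sub>0 \<longleftrightarrow> ordinary_cusp I c t\<^sub>0 \<and> cuspidal_curvature c t\<^sub>0 < 0"

end

theory Submission
  imports Defs
begin

text \<open>Along the singular curve the second fundamental form vanishes identically, and this ties the two
  curves \<open>g = f \<circ> \<gamma>\<close> and \<open>c = \<nu> \<circ> \<gamma>\<close> to each other so tightly that the bending of \<open>g\<close> decides the side to which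
  the cusp of \<open>c\<close> opens.

  Write \<open>\<lambda> = det(f\<^sub>u, f\<^sub>v, \<nu>)\<close> and \<open>\<lambda>\<^sup>* = det(\<nu>\<^sub>u, \<nu>\<^sub>v, \<nu>)\<close>. On the regular set \<open>\<lambda>\<^sup>* = K \<lambda>\<close>
  (\<open>curvature_times_density\<close>). A bounded \<open>K\<close> therefore forces \<open>\<lambda>\<^sup>* = 0\<close> on \<open>\<gamma>\<close>, because the points just to
  the left of \<open>\<gamma>\<close> are regular (\<open>gauss_density_singular\<close>). So \<open>df\<close> and \<open>d\<nu>\<close> both have a kernel at \<open>\<gamma>(t)\<close>; the
  two kernels are independent since \<open>(f, \<nu>)\<close> is an immersion, and the symmetric form \<open>\<langle>df, d\<nu>\<rangle>\<close> vanishes on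
  each of them, hence altogether (\<open>second_fundamental_form_eq_0\<close>). In particular \<open>\<langle>g', c'\<rangle> = 0\<close>, besides
  \<open>\<langle>g', c\<rangle> = 0\<close>.

  As \<open>\<nu>\<close> has a cusp and \<open>\<gamma>\<close> consists of singular points of \<open>\<nu>\<close>, the curve \<open>c\<close> has an ordinary cusp with
  \<open>c'(0) = 0\<close> and \<open>c''(0) \<noteq> 0\<close> (\<open>gauss_map_cusp_along_singular_curve\<close>). Differentiating the two orthogonality
  relations at \<open>0\<close> gives \<open>det(c, c'', c''') = 2 |c''|\<^sup>2 / |g'|\<^sup>2 det(g', g'', c)\<close>
  (\<open>cuspidal_curvature_orthogonal_curve\<close>), so the cuspidal curvature has the sign of \<open>det(g', g'', \<nu>)\<close>.

  It remains to see that the singular curvature has this sign too. In an adapted chart \<open>\<gamma>\<close> runs along the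
  \<open>u\<close>-axis, in the direction of \<open>sgn u'\<close>; since \<open>\<lambda>\<close> is positive on the left of \<open>\<gamma>\<close>, \<open>sgn \<lambda>\<^sub>v = sgn u'\<close>, provided
  that \<open>d\<lambda>\<close> is non-zero at \<open>p\<close> (\<open>singular_curvature_in_sign\<close>, \<open>area_density_nondegenerate\<close>). The normal form of
  a cuspidal edge yields the latter and also the existence of an adapted chart
  (\<open>cuspidal_edge_adapted_chart\<close>).\<close>


section \<open>Calculus of smooth maps\<close>

lemma Ck_on_SucI:
  assumes "open S" "\<And>x. x \<in> S \<Longrightarrow> (f has_derivative f' x) (at x)" "\<And>v. Ck_on n S (\<lambda>x. f' x v)"
  shows "Ck_on (Suc n) S f"
proof -
  have e: "frechet_derivative f (at x) = f' x" if "x \<in> S" for x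
    using frechet_derivative_at[OF assms(2)[OF that]] by simp
  have "Ck_on n S (\<lambda>x. frechet_derivative f (at x) v)" for v
    using Ck_on_cong[OF assms(1), of "\<lambda>x. frechet_derivative f (at x) v" "\<lambda>x. f' x v"] e assms(3) by simp
  then show ?thesis using assms(2) by (auto simp: differentiable_def)
qed

lemma Ck_on_SucD:
  assumes "Ck_on (Suc n) S f"
  shows "x \<in> S \<Longrightarrow> (f has_derivative frechet_derivative f (at x)) (at x)"
    and "Ck_on n S (\<lambda>x. frechet_derivative f (at x) v)"
  using assms by (auto simp: frechet_derivative_works)

lemma Ck_on_Suc_imp: "Ck_on (Suc n) S f \<Longrightarrow> Ck_on n S f"
proof (induction n arbitrary: f)
  case 0
  then have "f differentiable (at x)" if "x \<in> S" for x using that by simp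
  then have "continuous_on S f"
    by (intro continuous_at_imp_continuous_on ballI differentiable_imp_continuous_within) auto
  then show ?case by simp
next
  case (Suc n)
  then show ?case by (metis Ck_on.simps(2))
qed

lemma Ck_on_const: "Ck_on n S (\<lambda>x. c)"
  by (induction n arbitrary: c) auto

lemma Ck_on_bounded_linear:
  assumes "open S" "bounded_linear L" "Ck_on n S f"
  shows "Ck_on n S (\<lambda>x. L (f x))"
  using assms(3)
proof (induction n arbitrary: f)
  case 0
  then show ?case by (simp add: bounded_linear.continuous_on[OF assms(2)])
next
  case (Suc n)
  show ?case
    by (rule Ck_on_SucI[OF assms(1), where f' = "\<lambda>x v. L (frechet_derivative f (at x) v)"])
      (auto intro: Suc.IH Ck_on_SucD[OF Suc.prems] bounded_linear.has_derivative[OF assms(2)])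
qed

lemma Ck_on_ident: "open S \<Longrightarrow> Ck_on n S (\<lambda>x. x)"
proof (cases n)
  case (Suc m)
  assume "open S"
  then show ?thesis unfolding Suc
    by (rule Ck_on_SucI[where f' = "\<lambda>x v. v"]) (auto intro: Ck_on_const derivative_intros)
qed simp

lemma Ck_on_add:
  assumes "open S" "Ck_on n S f" "Ck_on n S g"
  shows "Ck_on n S (\<lambda>x. f x + g x)"
  using assms(2,3)
proof (induction n arbitrary: f g)
  case 0
  then show ?case by (simp add: continuous_on_add)
next
  case (Suc n)
  show ?case
    by (rule Ck_on_SucI[OF assms(1),
          where f' = "\<lambda>x v. frechet_derivative f (at x) v + frechet_derivative g (at x) v"])
      (intro Suc.IH Ck_on_SucD[OF Suc.prems(1)] Ck_on_SucD[OF Suc.prems(2)] has_derivative_add | assumption)+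
qed

lemma Ck_on_sum:
  assumes "open S" "\<And>i. i \<in> I \<Longrightarrow> Ck_on n S (f i)"
  shows "Ck_on n S (\<lambda>x. \<Sum>i\<in>I. f i x)"
  using assms(2)
  by (induction I rule: infinite_finite_induct) (auto simp: Ck_on_const Ck_on_add[OF assms(1)])

lemma Ck_on_bilinear:
  assumes "open S" "bounded_bilinear B" "Ck_on n S f" "Ck_on n S g"
  shows "Ck_on n S (\<lambda>x. B (f x) (g x))"
  using assms(3,4)
proof (induction n arbitrary: f g)
  case 0
  then show ?case by (simp add: bounded_bilinear.continuous_on[OF assms(2)])
next
  case (Suc n)
  show ?case
    by (rule Ck_on_SucI[OF assms(1), where f' = "\<lambda>x v. B (f x) (frechet_derivative g (at x) v) +
          B (frechet_derivative f (at x) v) (g x)"])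
      (intro Ck_on_add[OF assms(1)] Suc.IH Ck_on_SucD[OF Suc.prems(1)]
          Ck_on_SucD[OF Suc.prems(2)] Ck_on_Suc_imp[OF Suc.prems(1)] Ck_on_Suc_imp[OF Suc.prems(2)]
          bounded_bilinear.FDERIV[OF assms(2)] | assumption)+
qed

text \<open>The derivative of a composition is \<open>D\<^sub>v (g \<circ> f) = \<Sum>\<^sub>b (D\<^sub>v f \<bullet> b) D\<^sub>b g \<circ> f\<close>, a sum of products of
  maps of one order less; so the induction on the order is closed under the product rule.\<close>

lemma Ck_on_compose:
  fixes f :: "'a::real_normed_vector \<Rightarrow> 'b::euclidean_space"
  assumes "open S" "f ` S \<subseteq> T" "Ck_on n S f" "Ck_on n T g"
  shows "Ck_on n S (\<lambda>x. g (f x))"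
  using assms(3,4)
proof (induction n arbitrary: g)
  case 0
  then show ?case
    using assms(2) continuous_on_compose2[of T g S f] by simp
next
  case (Suc n)
  let ?D = "\<lambda>x v. \<Sum>b\<in>Basis. (frechet_derivative f (at x) v \<bullet> b) *\<^sub>R frechet_derivative g (at (f x)) b"
  show ?case
  proof (rule Ck_on_SucI[OF assms(1), where f' = ?D])
    fix x assume x: "x \<in> S"
    have fx: "f x \<in> T" using x assms(2) by blast
    have dg: "(g has_derivative frechet_derivative g (at (f x))) (at (f x))"
      by (rule Ck_on_SucD(1)[OF Suc.prems(2) fx])
    have df: "(f has_derivative frechet_derivative f (at x)) (at x)"
      by (rule Ck_on_SucD(1)[OF Suc.prems(1) x])
    have lin: "linear (frechet_derivative g (at (f x)))"
      using dg has_derivative_linear by blast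
    have "?D x v = frechet_derivative g (at (f x)) (frechet_derivative f (at x) v)" for v
    proof -
      have "frechet_derivative g (at (f x)) (frechet_derivative f (at x) v)
          = frechet_derivative g (at (f x)) (\<Sum>b\<in>Basis. (frechet_derivative f (at x) v \<bullet> b) *\<^sub>R b)"
        by (simp add: euclidean_representation)
      also have "\<dots> = ?D x v"
        by (simp add: linear_sum[OF lin] linear_scale[OF lin])
      finally show ?thesis by simp
    qed
    then have "?D x = (\<lambda>v. frechet_derivative g (at (f x)) (frechet_derivative f (at x) v))" by auto
    then show "((\<lambda>x. g (f x)) has_derivative ?D x) (at x)"
      using has_derivative_compose[OF df dg] by simp
  next
    fix v
    show "Ck_on n S (\<lambda>x. ?D x v)"
      by (intro Ck_on_sum Ck_on_bilinear[OF _ bounded_bilinear_scaleR] Suc.IH assms(1)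
          Ck_on_bounded_linear[OF _ bounded_linear_inner_left]
          Ck_on_SucD[OF Suc.prems(1)] Ck_on_SucD[OF Suc.prems(2)] Ck_on_Suc_imp[OF Suc.prems(1)])
  qed
qed

lemma Ck_on_inverse:
  fixes f :: "'a::real_normed_vector \<Rightarrow> real"
  assumes "open S" "\<And>x. x \<in> S \<Longrightarrow> f x \<noteq> 0" "Ck_on n S f"
  shows "Ck_on n S (\<lambda>x. inverse (f x))"
  using assms(3)
proof (induction n)
  case 0
  then show ?case using assms(2) by (auto intro: continuous_on_inverse)
next
  case (Suc n)
  note inv = Suc.IH[OF Ck_on_Suc_imp[OF Suc.prems]]
  show ?case
  proof (rule Ck_on_SucI[OF assms(1),
        where f' = "\<lambda>x v. - (inverse (f x) * frechet_derivative f (at x) v * inverse (f x))"])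
    fix x assume x: "x \<in> S"
    show "((\<lambda>x. inverse (f x)) has_derivative
        (\<lambda>v. - (inverse (f x) * frechet_derivative f (at x) v * inverse (f x)))) (at x)"
      by (rule Deriv.has_derivative_inverse[OF assms(2)[OF x] Ck_on_SucD(1)[OF Suc.prems x]])
  next
    fix v
    have "Ck_on n S (\<lambda>x. inverse (f x) * frechet_derivative f (at x) v * inverse (f x))"
      by (intro Ck_on_bilinear[OF _ bounded_bilinear_mult] assms(1) inv Ck_on_SucD(2)[OF Suc.prems])
    then show "Ck_on n S (\<lambda>x. - (inverse (f x) * frechet_derivative f (at x) v * inverse (f x)))"
      by (rule Ck_on_bounded_linear[OF assms(1) bounded_linear_minus[OF bounded_linear_ident]])
  qed
qed

lemma smooth_onE:
  assumes "smooth_on A f" "x \<in> A"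
  obtains U F where "open U" "x \<in> U" "\<forall>n. Ck_on n U F" "\<forall>y\<in>U \<inter> A. F y = f y"
  using assms(1)[unfolded smooth_on_def, rule_format, OF assms(2)] by auto

lemma smooth_onI:
  assumes "\<And>x. x \<in> A \<Longrightarrow>
    \<exists>U F. open U \<and> x \<in> U \<and> (\<forall>n. Ck_on n U F) \<and> (\<forall>y\<in>U \<inter> A. F y = f y)"
  shows "smooth_on A f"
  using assms unfolding smooth_on_def by simp

lemma smooth_on_subset:
  assumes "smooth_on A f" "B \<subseteq> A"
  shows "smooth_on B f"
proof (rule smooth_onI)
  fix x assume "x \<in> B"
  then have "x \<in> A" using assms(2) by blast
  then obtain U F where "open U" "x \<in> U" "\<forall>n. Ck_on n U F" "\<forall>y\<in>U \<inter> A. F y = f y"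
    by (rule smooth_onE[OF assms(1)])
  then show "\<exists>U F. open U \<and> x \<in> U \<and> (\<forall>n. Ck_on n U F) \<and> (\<forall>y\<in>U \<inter> B. F y = f y)"
    using assms(2) by (intro exI[of _ U] exI[of _ F]) auto
qed

lemma smooth_on_cong:
  assumes "\<And>x. x \<in> A \<Longrightarrow> f x = g x" "smooth_on A f"
  shows "smooth_on A g"
proof (rule smooth_onI)
  fix x assume "x \<in> A"
  then obtain U F where "open U" "x \<in> U" "\<forall>n. Ck_on n U F" "\<forall>y\<in>U \<inter> A. F y = f y"
    by (rule smooth_onE[OF assms(2)])
  then show "\<exists>U F. open U \<and> x \<in> U \<and> (\<forall>n. Ck_on n U F) \<and> (\<forall>y\<in>U \<inter> A. F y = g y)"
    using assms(1) by (intro exI[of _ U] exI[of _ F]) auto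
qed

lemma smooth_on_compose:
  assumes "smooth_on A f" "smooth_on B g" "f ` A \<subseteq> B"
  shows "smooth_on A (\<lambda>x. g (f x))"
proof (rule smooth_onI)
  fix x assume x: "x \<in> A"
  obtain U F where U: "open U" "x \<in> U" "\<forall>n. Ck_on n U F" "\<forall>y\<in>U \<inter> A. F y = f y"
    using smooth_onE[OF assms(1) x] .
  have "f x \<in> B" using assms(3) x by blast
  then obtain V G where V: "open V" "f x \<in> V" "\<forall>n. Ck_on n V G"
      "\<forall>y\<in>V \<inter> B. G y = g y"
    by (rule smooth_onE[OF assms(2)])
  have c: "continuous_on U F" using U(3)[rule_format, of 0] by simp
  define U' where "U' = U \<inter> F -` V"
  have o: "open U'" unfolding U'_def using continuous_open_preimage[OF c U(1) V(1)] .
  have "x \<in> U'" using U(2,4) V(2) x unfolding U'_def by auto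
  moreover have "Ck_on n U' (\<lambda>x. G (F x))" for n
    by (rule Ck_on_compose[OF o, where T = V]) (use U V in \<open>auto simp: U'_def intro: Ck_on_subset\<close>)
  moreover have "\<forall>y\<in>U' \<inter> A. G (F y) = g (f y)"
    using U(4) V(4) assms(3) unfolding U'_def by auto
  ultimately show "\<exists>U F. open U \<and> x \<in> U \<and> (\<forall>n. Ck_on n U F) \<and> (\<forall>y\<in>U \<inter> A. F y = g (f y))"
    using o by (intro exI[of _ U'] exI[of _ "\<lambda>x. G (F x)"]) auto
qed

lemma smooth_on_linear: "bounded_linear L \<Longrightarrow> smooth_on A L"
  by (rule smooth_on_subset[of UNIV])
    (simp_all add: smooth_on_open_iff Ck_on_bounded_linear[OF open_UNIV _ Ck_on_ident[OF open_UNIV]])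

lemma smooth_on_bounded_linear:
  "bounded_linear L \<Longrightarrow> smooth_on A f \<Longrightarrow> smooth_on A (\<lambda>x. L (f x))"
  by (rule smooth_on_compose[where B = UNIV]) (auto intro: smooth_on_linear)

lemma smooth_on_ident: "smooth_on A (\<lambda>x. x)"
  by (rule smooth_on_linear[OF bounded_linear_ident])

lemma smooth_on_const: "smooth_on A (\<lambda>x. c)"
  by (rule smooth_onI, rule exI[of _ UNIV]) (auto intro: Ck_on_const)

lemma smooth_on_add:
  "open S \<Longrightarrow> smooth_on S f \<Longrightarrow> smooth_on S g \<Longrightarrow> smooth_on S (\<lambda>x. f x + g x)"
  by (simp add: smooth_on_open_iff Ck_on_add)

lemma smooth_on_sum:
  "open S \<Longrightarrow> (\<And>i. i \<in> I \<Longrightarrow> smooth_on S (f i)) \<Longrightarrow> smooth_on S (\<lambda>x. \<Sum>i\<in>I. f i x)"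
  by (simp add: smooth_on_open_iff Ck_on_sum)

lemma smooth_on_bilinear:
  "open S \<Longrightarrow> bounded_bilinear B \<Longrightarrow> smooth_on S f \<Longrightarrow> smooth_on S g \<Longrightarrow> smooth_on S (\<lambda>x. B (f x) (g x))"
  by (simp add: smooth_on_open_iff Ck_on_bilinear)

lemmas smooth_on_scaleR = smooth_on_bilinear[OF _ bounded_bilinear_scaleR]
lemmas smooth_on_mult = smooth_on_bilinear[OF _ bounded_bilinear_mult]

lemma smooth_on_power:
  fixes f :: "'a::euclidean_space \<Rightarrow> real"
  shows "open S \<Longrightarrow> smooth_on S f \<Longrightarrow> smooth_on S (\<lambda>x. f x ^ n)"
  by (induction n) (auto intro: smooth_on_const smooth_on_mult)

lemma smooth_on_component: "smooth_on A f \<Longrightarrow> smooth_on A (\<lambda>x. f x $ i)"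
  for f :: "_ \<Rightarrow> real^'n"
  by (rule smooth_on_bounded_linear[OF bounded_linear_vec_nth])

lemma smooth_on_vecI:
  fixes f :: "'a::euclidean_space \<Rightarrow> real^'n"
  assumes "open S" "\<And>i. smooth_on S (\<lambda>x. f x $ i)"
  shows "smooth_on S f"
proof -
  have "smooth_on S (\<lambda>x. \<Sum>i\<in>UNIV. (f x $ i) *\<^sub>R (axis i 1 :: real^'n))"
    by (intro smooth_on_sum smooth_on_scaleR assms smooth_on_const)
  then show ?thesis
    by (rule smooth_on_cong[rotated])
      (simp add: vec_eq_iff axis_def if_distrib cong: if_cong)
qed

lemma smooth_on_vec2I:
  assumes "open S" "smooth_on S a" "smooth_on S b"
  shows "smooth_on S (\<lambda>x. vector [a x, b x] :: real^2)"
proof (rule smooth_on_vecI[OF assms(1)])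
  fix i :: 2 show "smooth_on S (\<lambda>x. (vector [a x, b x] :: real^2) $ i)"
    using exhaust_2[of i] assms by auto
qed

lemma smooth_on_vec3I:
  assumes "open S" "smooth_on S a" "smooth_on S b" "smooth_on S c"
  shows "smooth_on S (\<lambda>x. vector [a x, b x, c x] :: real^3)"
proof (rule smooth_on_vecI[OF assms(1)])
  fix i :: 3 show "smooth_on S (\<lambda>x. (vector [a x, b x, c x] :: real^3) $ i)"
    using exhaust_3[of i] assms by auto
qed

lemma smooth_on_has_derivative:
  "smooth_on S f \<Longrightarrow> open S \<Longrightarrow> x \<in> S \<Longrightarrow> (f has_derivative frechet_derivative f (at x)) (at x)"
  by (metis Ck_on_SucD(1) smooth_on_open_iff)

lemma smooth_on_linear_derivative:
  "smooth_on S f \<Longrightarrow> open S \<Longrightarrow> x \<in> S \<Longrightarrow> linear (frechet_derivative f (at x))"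
  using smooth_on_has_derivative has_derivative_linear by blast

lemma smooth_on_frechet_derivative:
  "smooth_on S f \<Longrightarrow> open S \<Longrightarrow> smooth_on S (\<lambda>x. frechet_derivative f (at x) v)"
  by (metis Ck_on_SucD(2) smooth_on_open_iff)

lemma smooth_on_pd: "smooth_on S f \<Longrightarrow> open S \<Longrightarrow> smooth_on S (pd i f)"
  unfolding pd_def[abs_def] by (rule smooth_on_frechet_derivative)

lemma smooth_on_imp_continuous_on: "smooth_on S f \<Longrightarrow> open S \<Longrightarrow> continuous_on S f"
  using smooth_on_open_iff Ck_on.simps(1) by blast

lemma smooth_on_isCont: "smooth_on S f \<Longrightarrow> open S \<Longrightarrow> x \<in> S \<Longrightarrow> isCont f x"
  using smooth_on_imp_continuous_on continuous_on_eq_continuous_at by blast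

lemma smooth_on_has_vector_derivative:
  "smooth_on S f \<Longrightarrow> open S \<Longrightarrow> t \<in> S \<Longrightarrow>
    (f has_vector_derivative vector_derivative f (at t)) (at t)"
  using smooth_on_has_derivative[of S f t]
  by (auto simp: vector_derivative_works[symmetric] differentiable_def)

lemma smooth_on_vector_derivative:
  assumes "smooth_on S f" "open S"
  shows "smooth_on S (\<lambda>t. vector_derivative f (at t))"
proof (rule smooth_on_cong[OF _ smooth_on_frechet_derivative[OF assms, of 1]])
  fix t assume "t \<in> S"
  then have "f differentiable at t" using smooth_on_has_derivative[OF assms] by (auto simp: differentiable_def)
  then show "frechet_derivative f (at t) 1 = vector_derivative f (at t)"
    by (simp add: frechet_derivative_eq_vector_derivative)
qed

lemma frechet_derivative_plane:
  fixes f :: "real^2 \<Rightarrow> 'b::real_normed_vector"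
  assumes "linear (frechet_derivative f (at q))"
  shows "frechet_derivative f (at q) X = X$1 *\<^sub>R pd 1 f q + X$2 *\<^sub>R pd 2 f q"
proof -
  have "X = X$1 *\<^sub>R axis 1 1 + X$2 *\<^sub>R axis 2 1"
    by (simp add: vec_eq_iff forall_2 axis_def)
  from arg_cong[OF this, of "frechet_derivative f (at q)"] show ?thesis
    by (simp add: pd_def linear_add[OF assms] linear_scale[OF assms])
qed

lemma smooth_on_chain:
  assumes "smooth_on S f" "open S" "smooth_on T g" "open T" "x \<in> S" "f x \<in> T"
  shows "frechet_derivative (\<lambda>x. g (f x)) (at x) v =
    frechet_derivative g (at (f x)) (frechet_derivative f (at x) v)"
  using has_derivative_compose[OF smooth_on_has_derivative[OF assms(1,2,5)]
      smooth_on_has_derivative[OF assms(3,4,6)]] frechet_derivative_at by metis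

lemma smooth_on_chain_curve:
  assumes "smooth_on S c" "open S" "smooth_on T g" "open T" "t \<in> S" "c t \<in> T"
  shows "((\<lambda>t. g (c t)) has_vector_derivative
    frechet_derivative g (at (c t)) (vector_derivative c (at t))) (at t)"
  using vector_derivative_diff_chain_within[OF smooth_on_has_vector_derivative[OF assms(1,2,5)]
      has_derivative_at_withinI[OF smooth_on_has_derivative[OF assms(3,4,6)]]]
  by (simp add: o_def)

text \<open>The left inverse \<open>\<Phi>\<close> is only smooth on a subset such as a piece of the sphere; differentiating a
  local extension of it along \<open>\<Psi>\<close> still shows that the derivative of \<open>\<Psi>\<close> has a left inverse.\<close>

lemma smooth_left_inverse_derivative_inj:
  assumes "smooth_on Z \<Psi>" "open Z" "smooth_on W \<Phi>" "\<Psi> ` Z \<subseteq> W" "\<And>z. z \<in> Z \<Longrightarrow> \<Phi> (\<Psi> z) = z"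
    and "z \<in> Z" "frechet_derivative \<Psi> (at z) v = 0"
  shows "v = 0"
proof -
  have "\<Psi> z \<in> W" using assms(4,6) by blast
  then obtain U F where U: "open U" "\<Psi> z \<in> U" "\<forall>n. Ck_on n U F"
      "\<forall>y\<in>U \<inter> W. F y = \<Phi> y"
    by (rule smooth_onE[OF assms(3)])
  have sF: "smooth_on U F" using U(3) by (simp add: smooth_on_open_iff[OF U(1)])
  define Z' where "Z' = Z \<inter> \<Psi> -` U"
  have o: "open Z'" unfolding Z'_def
    by (rule continuous_open_preimage[OF smooth_on_imp_continuous_on assms(2) U(1)]) (use assms in auto)
  have z: "z \<in> Z'" using U assms by (auto simp: Z'_def)
  have "((\<lambda>z. F (\<Psi> z)) has_derivative (\<lambda>v. frechet_derivative F (at (\<Psi> z)) (frechet_derivative \<Psi> (at z) v))) (at z)"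
    by (rule has_derivative_compose[OF smooth_on_has_derivative[OF assms(1,2,6)]
          smooth_on_has_derivative[OF sF U(1,2)]])
  moreover have "((\<lambda>z. F (\<Psi> z)) has_derivative (\<lambda>v. v)) (at z)"
    by (rule has_derivative_transform_within_open[OF has_derivative_ident o z])
      (use U assms in \<open>auto simp: Z'_def\<close>)
  ultimately have "(\<lambda>v. frechet_derivative F (at (\<Psi> z)) (frechet_derivative \<Psi> (at z) v)) = (\<lambda>v. v)"
    by (rule has_derivative_unique)
  then have "v = frechet_derivative F (at (\<Psi> z)) (frechet_derivative \<Psi> (at z) v)" by metis
  also have "\<dots> = 0" using assms(7) smooth_on_linear_derivative[OF sF U(1,2)] linear_0 by metis
  finally show ?thesis .
qed


section \<open>Symmetry of second derivatives\<close>

text \<open>The second difference of \<open>g\<close> over the parallelogram spanned by \<open>h u\<close> and \<open>h v\<close>, a quantity that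
  is symmetric in \<open>u\<close> and \<open>v\<close>, is \<open>h\<^sup>2\<close> times a value of \<open>D\<^sub>v D\<^sub>u g\<close>: apply the mean value theorem
  first along \<open>u\<close>, then along \<open>v\<close>.\<close>

lemma second_difference:
  fixes g :: "'a::euclidean_space \<Rightarrow> real"
  assumes g: "smooth_on S g" "open S" and h: "0 < h"
    and S: "\<And>s t. 0 \<le> s \<Longrightarrow> s \<le> h \<Longrightarrow> 0 \<le> t \<Longrightarrow> t \<le> h \<Longrightarrow> x + s *\<^sub>R u + t *\<^sub>R v \<in> S"
  shows "\<exists>s t. 0 \<le> s \<and> s \<le> h \<and> 0 \<le> t \<and> t \<le> h \<and>
    g (x + h *\<^sub>R u + h *\<^sub>R v) - g (x + h *\<^sub>R u) - g (x + h *\<^sub>R v) + g x =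
    h * h * frechet_derivative (\<lambda>y. frechet_derivative g (at y) u) (at (x + s *\<^sub>R u + t *\<^sub>R v)) v"
proof -
  have line: "((\<lambda>s. k (y + s *\<^sub>R w)) has_real_derivative frechet_derivative k (at (y + s *\<^sub>R w)) w) (at s)"
    if "smooth_on S k" "y + s *\<^sub>R w \<in> S" for k :: "'a \<Rightarrow> real" and y w s
  proof -
    have "((\<lambda>s. y + s *\<^sub>R w) has_derivative (\<lambda>d. d *\<^sub>R w)) (at s)"
      by (auto intro!: derivative_eq_intros)
    from has_derivative_compose[OF this smooth_on_has_derivative[OF that(1) g(2) that(2)]]
    show ?thesis
      by (simp add: has_field_derivative_def mult_commute_abs
          linear_scale[OF smooth_on_linear_derivative[OF that(1) g(2) that(2)]])
  qed
  define Du where "Du = (\<lambda>y. frechet_derivative g (at y) u)"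
  have Du: "smooth_on S Du" unfolding Du_def by (rule smooth_on_frechet_derivative[OF g])
  define \<phi> where "\<phi> s = g ((x + h *\<^sub>R v) + s *\<^sub>R u) - g (x + s *\<^sub>R u)" for s
  have "\<exists>s. 0 < s \<and> s < h \<and> \<phi> h - \<phi> 0 = (h - 0) * (Du ((x + h *\<^sub>R v) + s *\<^sub>R u) - Du (x + s *\<^sub>R u))"
  proof (rule MVT2[OF h])
    fix s assume s: "0 \<le> s" "s \<le> h"
    have "(x + h *\<^sub>R v) + s *\<^sub>R u \<in> S" "x + s *\<^sub>R u \<in> S"
      using S[of s h] S[of s 0] s h by (auto simp: algebra_simps)
    then show "DERIV \<phi> s :> Du ((x + h *\<^sub>R v) + s *\<^sub>R u) - Du (x + s *\<^sub>R u)"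
      unfolding \<phi>_def[abs_def] Du_def by (intro DERIV_diff line g)
  qed
  then obtain s where s: "0 < s" "s < h"
    "\<phi> h - \<phi> 0 = h * (Du ((x + h *\<^sub>R v) + s *\<^sub>R u) - Du (x + s *\<^sub>R u))" by auto
  have "\<exists>t. 0 < t \<and> t < h \<and> Du ((x + s *\<^sub>R u) + h *\<^sub>R v) - Du ((x + s *\<^sub>R u) + 0 *\<^sub>R v) =
      (h - 0) * frechet_derivative Du (at ((x + s *\<^sub>R u) + t *\<^sub>R v)) v"
  proof (rule MVT2[OF h])
    fix t assume t: "0 \<le> t" "t \<le> h"
    show "((\<lambda>t. Du ((x + s *\<^sub>R u) + t *\<^sub>R v)) has_real_derivative
        frechet_derivative Du (at ((x + s *\<^sub>R u) + t *\<^sub>R v)) v) (at t)"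
      by (rule line[OF Du]) (use S[of s t] s t in auto)
  qed
  then obtain t where t: "0 < t" "t < h" "Du (x + s *\<^sub>R u + h *\<^sub>R v) - Du (x + s *\<^sub>R u) =
      h * frechet_derivative Du (at (x + s *\<^sub>R u + t *\<^sub>R v)) v" by auto
  have "g (x + h *\<^sub>R u + h *\<^sub>R v) - g (x + h *\<^sub>R u) - g (x + h *\<^sub>R v) + g x = \<phi> h - \<phi> 0"
    by (simp add: \<phi>_def algebra_simps)
  also have "\<dots> = h * (Du (x + s *\<^sub>R u + h *\<^sub>R v) - Du (x + s *\<^sub>R u))"
    using s(3) by (simp add: algebra_simps)
  also have "\<dots> = h * h * frechet_derivative Du (at (x + s *\<^sub>R u + t *\<^sub>R v)) v"
    unfolding t(3) by simp
  finally show ?thesis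
    using s t unfolding Du_def by (intro exI[of _ s] exI[of _ t]) auto
qed

text \<open>As the parallelogram shrinks to the point \<open>x\<close>, the second difference divided by \<open>h\<^sup>2\<close> tends to either
  mixed derivative at \<open>x\<close>, by continuity.\<close>

lemma symmetric_second_derivative_real:
  fixes g :: "'a::euclidean_space \<Rightarrow> real"
  assumes g: "smooth_on S g" "open S" "x \<in> S"
  shows "frechet_derivative (\<lambda>y. frechet_derivative g (at y) u) (at x) v =
         frechet_derivative (\<lambda>y. frechet_derivative g (at y) v) (at x) u"
proof -
  define A where "A = (\<lambda>u v y. frechet_derivative (\<lambda>y. frechet_derivative g (at y) u) (at y) v)"
  have A: "isCont (A u v) x" for u v
    unfolding A_def by (intro smooth_on_isCont[OF _ g(2,3)] smooth_on_frechet_derivative g)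
  have "\<bar>A u v x - A v u x\<bar> \<le> e" if e: "0 < e" for e
  proof -
    have "\<forall>\<^sub>F y in nhds x. y \<in> S \<and> dist (A u v y) (A u v x) < e/2 \<and> dist (A v u y) (A v u x) < e/2"
      using eventually_nhds_in_open[OF g(2,3)]
        tendstoD[OF A[of u v, unfolded continuous_at tendsto_at_iff_tendsto_nhds], of "e/2"]
        tendstoD[OF A[of v u, unfolded continuous_at tendsto_at_iff_tendsto_nhds], of "e/2"] e
      by (intro eventually_conj) simp_all
    then obtain d where d: "0 < d" "\<And>y. dist y x < d \<Longrightarrow>
        y \<in> S \<and> dist (A u v y) (A u v x) < e/2 \<and> dist (A v u y) (A v u x) < e/2"
      unfolding eventually_nhds_metric by blast
    \<comment> \<open>So small that the parallelogram lies in the ball of radius \<open>d\<close>.\<close>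
    define h where "h = d / (2 * (norm u + norm v + 1))"
    have n: "norm u + norm v + 1 > 0" by (simp add: add_nonneg_pos)
    have h: "0 < h" using d(1) n by (simp add: h_def)
    have near: "dist (x + s *\<^sub>R a + t *\<^sub>R b) x < d"
      if "0 \<le> s" "s \<le> h" "0 \<le> t" "t \<le> h" "{a, b} = {u, v}" for s t a b
    proof -
      have "norm a + norm b \<le> norm u + norm v" using that(5) by (auto simp: doubleton_eq_iff)
      have "dist (x + s *\<^sub>R a + t *\<^sub>R b) x \<le> s * norm a + t * norm b"
        using norm_triangle_ineq[of "s *\<^sub>R a" "t *\<^sub>R b"] that by (simp add: dist_norm add.assoc)
      also have "\<dots> \<le> h * norm a + h * norm b"
        using that by (intro add_mono mult_right_mono) auto
      also have "\<dots> \<le> h * (norm u + norm v)"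
        using \<open>norm a + norm b \<le> norm u + norm v\<close> h by (simp add: distrib_left[symmetric])
      also have "\<dots> < h * (2 * (norm u + norm v + 1))" 
      proof (rule mult_strict_left_mono[OF _ h])
        show "norm u + norm v < 2 * (norm u + norm v + 1)"
          using n by (simp add: distrib_left)
      qed
      also have "\<dots> = d" using n by (simp add: h_def)
      finally show ?thesis .
    qed
    obtain s t where st: "0 \<le> s" "s \<le> h" "0 \<le> t" "t \<le> h"
      "g (x + h *\<^sub>R u + h *\<^sub>R v) - g (x + h *\<^sub>R u) - g (x + h *\<^sub>R v) + g x =
       h * h * A u v (x + s *\<^sub>R u + t *\<^sub>R v)"
      using second_difference[OF g(1,2) h, of x u v] d(2) near unfolding A_def by auto
    obtain s' t' where st': "0 \<le> s'" "s' \<le> h" "0 \<le> t'" "t' \<le> h"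
      "g (x + h *\<^sub>R v + h *\<^sub>R u) - g (x + h *\<^sub>R v) - g (x + h *\<^sub>R u) + g x =
       h * h * A v u (x + s' *\<^sub>R v + t' *\<^sub>R u)"
      using second_difference[OF g(1,2) h, of x v u] d(2) near[of _ _ v u] unfolding A_def
      by (auto simp: insert_commute)
    have "h * h * A u v (x + s *\<^sub>R u + t *\<^sub>R v) = h * h * A v u (x + s' *\<^sub>R v + t' *\<^sub>R u)"
      unfolding st(5)[symmetric] st'(5)[symmetric] by (simp add: algebra_simps)
    then have "A u v (x + s *\<^sub>R u + t *\<^sub>R v) = A v u (x + s' *\<^sub>R v + t' *\<^sub>R u)" using h by simp
    moreover have "dist (A u v (x + s *\<^sub>R u + t *\<^sub>R v)) (A u v x) < e/2"
      using d(2)[OF near] st by blast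
    moreover have "dist (A v u (x + s' *\<^sub>R v + t' *\<^sub>R u)) (A v u x) < e/2"
      using d(2)[OF near[of s' t' v u]] st' by (auto simp: insert_commute)
    ultimately show ?thesis unfolding dist_real_def by linarith
  qed
  then have "A u v x = A v u x" using field_le_epsilon[of "\<bar>A u v x - A v u x\<bar>" 0] by auto
  then show ?thesis by (simp add: A_def)
qed

lemma frechet_derivative_bounded_linear:
  assumes "smooth_on S f" "open S" "x \<in> S" "bounded_linear L"
  shows "frechet_derivative (\<lambda>y. L (f y)) (at x) v = L (frechet_derivative f (at x) v)"
  using bounded_linear.has_derivative[OF assms(4) smooth_on_has_derivative[OF assms(1-3)]]
    frechet_derivative_at by metis

lemma symmetric_second_derivative:
  fixes f :: "'a::euclidean_space \<Rightarrow> 'b::euclidean_space"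
  assumes f: "smooth_on S f" "open S" "x \<in> S"
  shows "frechet_derivative (\<lambda>y. frechet_derivative f (at y) u) (at x) v =
         frechet_derivative (\<lambda>y. frechet_derivative f (at y) v) (at x) u"
proof (rule euclidean_eqI)
  fix b :: 'b assume "b \<in> Basis"
  have L: "bounded_linear (\<lambda>z. z \<bullet> b)" by (rule bounded_linear_inner_left)
  have e: "frechet_derivative (\<lambda>y. frechet_derivative f (at y) u) (at x) v \<bullet> b =
      frechet_derivative (\<lambda>y. frechet_derivative (\<lambda>y. f y \<bullet> b) (at y) u) (at x) v" for u v
  proof -
    have "((\<lambda>y. frechet_derivative f (at y) u \<bullet> b) has_derivative
        (\<lambda>v. frechet_derivative (\<lambda>y. frechet_derivative f (at y) u) (at x) v \<bullet> b)) (at x)"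
      by (rule bounded_linear.has_derivative[OF L
            smooth_on_has_derivative[OF smooth_on_frechet_derivative[OF f(1,2)] f(2,3)]])
    then have "((\<lambda>y. frechet_derivative (\<lambda>y. f y \<bullet> b) (at y) u) has_derivative
        (\<lambda>v. frechet_derivative (\<lambda>y. frechet_derivative f (at y) u) (at x) v \<bullet> b)) (at x)"
      by (rule has_derivative_transform_within_open[OF _ f(2,3)])
        (simp add: frechet_derivative_bounded_linear[OF f(1,2) _ L])
    from frechet_derivative_at[OF this] show ?thesis by metis
  qed
  show "frechet_derivative (\<lambda>y. frechet_derivative f (at y) u) (at x) v \<bullet> b =
        frechet_derivative (\<lambda>y. frechet_derivative f (at y) v) (at x) u \<bullet> b"
    unfolding e by (rule symmetric_second_derivative_real[OF smooth_on_bounded_linear[OF L f(1)] f(2,3)])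
qed

section \<open>Diffeomorphisms and normal forms\<close>

lemma diffeo_betweenE:
  assumes "diffeo_between A B \<phi>"
  obtains \<psi> where "homeomorphism A B \<phi> \<psi>" "smooth_on A \<phi>" "smooth_on B \<psi>"
  using assms unfolding diffeo_between_def by (elim exE conjE) (rule that)

text \<open>The inverse \<open>w\<close> satisfies \<open>w' = 1 / (v' \<circ> w)\<close>, so its order of differentiability increases by one
  at each step of an induction.\<close>

lemma smooth_real_diffeo:
  fixes v :: "real \<Rightarrow> real"
  assumes v: "smooth_on {a<..<b} v" and nz: "\<And>t. t \<in> {a<..<b} \<Longrightarrow> vector_derivative v (at t) \<noteq> 0"
  shows "open (v ` {a<..<b})" "diffeo_between {a<..<b} (v ` {a<..<b}) v"
proof -
  let ?I = "{a<..<b}"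
  define v' where "v' t = vector_derivative v (at t)" for t
  have d: "(v has_real_derivative v' t) (at t)" if "t \<in> ?I" for t
    using smooth_on_has_vector_derivative[OF v _ that] unfolding v'_def
    by (simp add: has_real_derivative_iff_has_vector_derivative)
  have c: "continuous_on ?I v" using smooth_on_imp_continuous_on[OF v] by simp
  have inj: "inj_on v ?I"
  proof (rule linorder_inj_onI)
    fix s t assume st: "s < t" "s \<in> ?I" "t \<in> ?I"
    have "\<exists>z. s < z \<and> z < t \<and> v t - v s = (t - s) * v' z"
      by (rule MVT2[OF st(1)]) (use st in \<open>auto intro: d\<close>)
    then obtain z where z: "s < z" "z < t" "v t - v s = (t - s) * v' z" by blast
    then have "v' z \<noteq> 0" using nz[of z] st unfolding v'_def by auto
    then show "v s \<noteq> v t" using z st by auto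
  qed auto
  show o: "open (v ` ?I)" by (rule invariance_of_domain[OF c _ inj]) simp
  obtain w where w: "homeomorphism ?I (v ` ?I) v w"
    by (rule invariance_of_domain_homeomorphism[OF _ c _ inj]) auto
  have wI: "w y \<in> ?I" "v (w y) = y" if "y \<in> v ` ?I" for y
    using w that unfolding homeomorphism_def by blast+
  have dw: "(w has_derivative (*) (inverse (v' (w y)))) (at y)" if y: "y \<in> v ` ?I" for y
  proof -
    have "(v has_derivative (*) (v' (w y))) (at (w y))"
      using d[OF wI(1)[OF y]] by (simp add: has_field_derivative_def)
    moreover have "(*) (inverse (v' (w y))) \<circ> (*) (v' (w y)) = id"
      using nz[OF wI(1)[OF y]] by (auto simp: v'_def)
    moreover have "continuous (at y) w"
      using w o y by (metis continuous_on_eq_continuous_at homeomorphism_cont2)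
    ultimately show ?thesis
      using wI(2) by (intro has_derivative_inverse_basic[OF _ bounded_linear_mult_right _ _ o y])
  qed
  have sv': "smooth_on ?I v'" unfolding v'_def[abs_def] by (rule smooth_on_vector_derivative[OF v]) simp
  have "Ck_on n (v ` ?I) w" for n
  proof (induction n)
    case 0
    then show ?case using w by (simp add: homeomorphism_def)
  next
    case (Suc n)
    show ?case
    proof (rule Ck_on_SucI[OF o, where f' = "\<lambda>y d. inverse (v' (w y)) * d"])
      show "(w has_derivative (*) (inverse (v' (w y)))) (at y)" if "y \<in> v ` ?I" for y
        using dw[OF that] .
      have "Ck_on n (v ` ?I) (\<lambda>y. v' (w y))"
        by (rule Ck_on_compose[OF o _ Suc.IH, where T = ?I]) (use wI sv' in \<open>auto simp: smooth_on_open_iff\<close>)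
      then have "Ck_on n (v ` ?I) (\<lambda>y. inverse (v' (w y)))"
        by (rule Ck_on_inverse[OF o, rotated]) (use wI nz in \<open>auto simp: v'_def\<close>)
      then show "Ck_on n (v ` ?I) (\<lambda>y. inverse (v' (w y)) * d)" for d
        by (rule Ck_on_bilinear[OF o bounded_bilinear_mult _ Ck_on_const])
    qed
  qed
  then have "smooth_on (v ` ?I) w" by (simp add: smooth_on_open_iff[OF o])
  then show "diffeo_between ?I (v ` ?I) v" unfolding diffeo_between_def using w v by blast
qed

text \<open>Inverting the target diffeomorphism \<open>\<Phi>\<close> expresses \<open>f\<close> itself through the model. When \<open>N\<close> is the
  sphere, \<open>\<Phi>\<close> lives on a surface, but its inverse \<open>\<Psi>\<close> is defined on an open set and has a derivative
  there.\<close>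

lemma A_equivalent_normal_form:
  fixes g :: "'c::euclidean_space \<Rightarrow> 'd::euclidean_space"
  assumes "A_equivalent M N f p UNIV UNIV g 0" "open M"
  obtains U V W Z \<phi> \<psi> \<Phi> \<Psi> where
    "open U" "U \<subseteq> M" "p \<in> U" "open V" "0 \<in> V" "homeomorphism U V \<phi> \<psi>" "smooth_on U \<phi>" "smooth_on V \<psi>"
    "\<phi> p = 0" "openin (top_of_set N) W" "open Z" "homeomorphism W Z \<Phi> \<Psi>" "smooth_on W \<Phi>" "smooth_on Z \<Psi>"
    "f ` U \<subseteq> W" "g ` V \<subseteq> Z" "\<And>q. q \<in> U \<Longrightarrow> f q = \<Psi> (g (\<phi> q))"
proof -
  have "\<exists>U V W Z \<phi> \<Phi>. openin (top_of_set M) U \<and> p \<in> U \<and> open V \<and> 0 \<in> V \<and>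
    openin (top_of_set N) W \<and> open Z \<and> f ` U \<subseteq> W \<and> g ` V \<subseteq> Z \<and> diffeo_between U V \<phi> \<and> \<phi> p = 0 \<and>
    diffeo_between W Z \<Phi> \<and> (\<forall>q\<in>U. \<Phi> (f q) = g (\<phi> q))"
    using assms(1) unfolding A_equivalent_def subtopology_UNIV open_openin[symmetric] .
  then obtain U V W Z \<phi> \<Phi> where *: "openin (top_of_set M) U" "p \<in> U" "open V" "0 \<in> V"
    "openin (top_of_set N) W" "open Z" "f ` U \<subseteq> W" "g ` V \<subseteq> Z" "diffeo_between U V \<phi>" "\<phi> p = 0"
    "diffeo_between W Z \<Phi>" "\<forall>q\<in>U. \<Phi> (f q) = g (\<phi> q)"
    by (elim exE conjE) (rule that)
  obtain \<psi> where \<psi>: "homeomorphism U V \<phi> \<psi>" "smooth_on U \<phi>" "smooth_on V \<psi>"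
    using diffeo_betweenE[OF *(9)] .
  obtain \<Psi> where \<Psi>: "homeomorphism W Z \<Phi> \<Psi>" "smooth_on W \<Phi>" "smooth_on Z \<Psi>"
    using diffeo_betweenE[OF *(11)] .
  have "open U" "U \<subseteq> M" using *(1) assms(2) openin_open_eq by auto
  moreover have "f q = \<Psi> (g (\<phi> q))" if "q \<in> U" for q
    using that *(7,12) homeomorphism_apply1[OF \<Psi>(1), of "f q"] by auto
  ultimately show ?thesis
    using that[of U V \<phi> \<psi> W Z \<Phi> \<Psi>] *(2-8,10) \<psi> \<Psi> by simp
qed

text \<open>The chain rule for \<open>\<Psi> \<circ> k\<close> where \<open>k' = 0\<close>: the second derivative of \<open>\<Psi>\<close> does not enter.\<close>

lemma second_derivative_at_stationary_point:
  fixes k :: "real \<Rightarrow> 'a::euclidean_space"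
  assumes k: "smooth_on S k" "open S" and \<Psi>: "smooth_on Z \<Psi>" "open Z" and "k ` S \<subseteq> Z" "t \<in> S"
    and k0: "vector_derivative k (at t) = 0"
  shows "vector_derivative (\<lambda>t. \<Psi> (k t)) (at t) = 0"
    and "vector_derivative (\<lambda>s. vector_derivative (\<lambda>t. \<Psi> (k t)) (at s)) (at t) =
      frechet_derivative \<Psi> (at (k t)) (vector_derivative (\<lambda>s. vector_derivative k (at s)) (at t))"
proof -
  define k' where "k' s = vector_derivative k (at s)" for s
  have sk': "smooth_on S k'" unfolding k'_def[abs_def] by (rule smooth_on_vector_derivative[OF k])
  have kZ: "k s \<in> Z" if "s \<in> S" for s using that assms(5) by blast
  let ?D = "\<lambda>s. \<Sum>b\<in>Basis. (k' s \<bullet> b) *\<^sub>R frechet_derivative \<Psi> (at (k s)) b"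
  have expand: "frechet_derivative \<Psi> (at (k s)) w = (\<Sum>b\<in>Basis. (w \<bullet> b) *\<^sub>R frechet_derivative \<Psi> (at (k s)) b)"
    if "s \<in> S" for s w
  proof -
    note lin = smooth_on_linear_derivative[OF \<Psi> kZ[OF that]]
    have "frechet_derivative \<Psi> (at (k s)) w = frechet_derivative \<Psi> (at (k s)) (\<Sum>b\<in>Basis. (w \<bullet> b) *\<^sub>R b)"
      by (simp add: euclidean_representation)
    also have "\<dots> = (\<Sum>b\<in>Basis. (w \<bullet> b) *\<^sub>R frechet_derivative \<Psi> (at (k s)) b)"
      by (simp add: linear_sum[OF lin] linear_scale[OF lin])
    finally show ?thesis .
  qed
  have d: "vector_derivative (\<lambda>t. \<Psi> (k t)) (at s) = ?D s" if "s \<in> S" for s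
    using trans[OF vector_derivative_at[OF smooth_on_chain_curve[OF k \<Psi> that kZ[OF that]]]
        expand[OF that]] unfolding k'_def .
  show "vector_derivative (\<lambda>t. \<Psi> (k t)) (at t) = 0"
    using d[OF \<open>t \<in> S\<close>] k0 by (simp add: k'_def)
  have "((\<lambda>s. (k' s \<bullet> b) *\<^sub>R frechet_derivative \<Psi> (at (k s)) b) has_vector_derivative
     (vector_derivative k' (at t) \<bullet> b) *\<^sub>R frechet_derivative \<Psi> (at (k t)) b) (at t)" for b
  proof -
    have 1: "((\<lambda>s. k' s \<bullet> b) has_vector_derivative vector_derivative k' (at t) \<bullet> b) (at t)"
      using bounded_linear.has_vector_derivative[OF bounded_linear_inner_left
          smooth_on_has_vector_derivative[OF sk' k(2) \<open>t \<in> S\<close>]] .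
    have "smooth_on S (\<lambda>s. frechet_derivative \<Psi> (at (k s)) b)"
      by (rule smooth_on_compose[OF k(1) smooth_on_frechet_derivative[OF \<Psi>] assms(5)])
    from smooth_on_has_vector_derivative[OF this k(2) \<open>t \<in> S\<close>]
    have 2: "((\<lambda>s. frechet_derivative \<Psi> (at (k s)) b) has_vector_derivative
        vector_derivative (\<lambda>s. frechet_derivative \<Psi> (at (k s)) b) (at t)) (at t)" .
    show ?thesis
      using bounded_bilinear.has_vector_derivative[OF bounded_bilinear_scaleR 1 2] k0
      by (simp add: k'_def)
  qed
  then have "(?D has_vector_derivative
      (\<Sum>b\<in>Basis. (vector_derivative k' (at t) \<bullet> b) *\<^sub>R frechet_derivative \<Psi> (at (k t)) b)) (at t)"
    by (intro has_vector_derivative_sum)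
  then have "(?D has_vector_derivative frechet_derivative \<Psi> (at (k t)) (vector_derivative k' (at t))) (at t)"
    unfolding expand[OF \<open>t \<in> S\<close>, of "vector_derivative k' (at t)"] .
  then have "((\<lambda>s. vector_derivative (\<lambda>t. \<Psi> (k t)) (at s)) has_vector_derivative
      frechet_derivative \<Psi> (at (k t)) (vector_derivative k' (at t))) (at t)"
    by (rule has_vector_derivative_transform_within_open[OF _ k(2) \<open>t \<in> S\<close>]) (simp add: d)
  then show "vector_derivative (\<lambda>s. vector_derivative (\<lambda>t. \<Psi> (k t)) (at s)) (at t) =
      frechet_derivative \<Psi> (at (k t)) (vector_derivative (\<lambda>s. vector_derivative k (at s)) (at t))"
    unfolding k'_def[abs_def] by (rule vector_derivative_at)
qed


section \<open>Triple products and the plane\<close>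

lemma det3_cross: "det3 a b c = a \<bullet> cross3 b c"
  by (simp add: det3_def dot_cross_det)

lemma det3_expand:
  "det3 a b c = a$1 * (b$2 * c$3 - b$3 * c$2) + a$2 * (b$3 * c$1 - b$1 * c$3) + a$3 * (b$1 * c$2 - b$2 * c$1)"
  by (simp add: det3_def det_3 algebra_simps)

lemma inner_real3: "x \<bullet> y = x$1 * y$1 + x$2 * y$2 + x$3 * y$3" for x y :: "real^3"
  by (simp add: inner_vec_def sum_3)

lemma det3_cyclic: "det3 a b c = det3 b c a"
  by (simp add: det3_expand algebra_simps)

lemma bounded_bilinear_cross3: "bounded_bilinear cross3"
  using bilinear_cross bilinear_conv_bounded_bilinear by blast

lemma smooth_on_det3:
  "open S \<Longrightarrow> smooth_on S a \<Longrightarrow> smooth_on S b \<Longrightarrow> smooth_on S c \<Longrightarrow> smooth_on S (\<lambda>x. det3 (a x) (b x) (c x))"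
  unfolding det3_cross
  by (intro smooth_on_bilinear[OF _ bounded_bilinear_inner] smooth_on_bilinear[OF _ bounded_bilinear_cross3])

text \<open>The product of two determinants is the determinant of the matrix of inner products; the row of the
  common unit normal \<open>n\<close> contributes the factor 1.\<close>

lemma det3_mult:
  assumes "n \<bullet> n = 1" "a \<bullet> n = 0" "c \<bullet> n = 0" "d \<bullet> n = 0"
  shows "det3 a b n * det3 c d n = (a \<bullet> c) * (b \<bullet> d) - (a \<bullet> d) * (b \<bullet> c)"
proof -
  have "det3 a b n * det3 c d n =
    (a \<bullet> c) * ((b \<bullet> d) * (n \<bullet> n) - (b \<bullet> n) * (n \<bullet> d)) - (a \<bullet> d) * ((b \<bullet> c) * (n \<bullet> n) - (b \<bullet> n) * (n \<bullet> c))
    + (a \<bullet> n) * ((b \<bullet> c) * (n \<bullet> d) - (b \<bullet> d) * (n \<bullet> c))"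
    unfolding det3_expand inner_real3 by algebra
  then show ?thesis using assms by (simp add: inner_commute)
qed

lemma det3_eq_0_imp_dependent:
  assumes "n \<bullet> n = 1" "a \<bullet> n = 0" "b \<bullet> n = 0" "det3 a b n = 0"
  shows "\<exists>X::real^2. X \<noteq> 0 \<and> X$1 *\<^sub>R a + X$2 *\<^sub>R b = 0"
proof (cases "a = 0")
  case True
  then show ?thesis by (intro exI[of _ "axis 1 1"]) (auto simp: axis_def vec_eq_iff forall_2)
next
  case False
  let ?X = "vector [- (a \<bullet> b), a \<bullet> a] :: real^2"
  let ?s = "?X$1 *\<^sub>R a + ?X$2 *\<^sub>R b"
  have g: "(a \<bullet> a) * (b \<bullet> b) - (a \<bullet> b) * (a \<bullet> b) = 0"
    using det3_mult[OF assms(1,2,2,3), of b] assms(4) by (simp add: inner_commute)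
  have "?s \<bullet> ?s = (a \<bullet> a) * ((a \<bullet> a) * (b \<bullet> b) - (a \<bullet> b) * (a \<bullet> b))"
    by (simp add: inner_add_left inner_add_right inner_commute[of b a] algebra_simps)
  then have "?s = 0" using g by simp
  moreover have "?X \<noteq> 0" using False by (auto simp: vec_eq_iff forall_2)
  ultimately show ?thesis by blast
qed

lemma dependent_imp_det3_eq_0:
  fixes X :: "real^2"
  assumes "X \<noteq> 0" "X$1 *\<^sub>R a + X$2 *\<^sub>R b = 0"
  shows "det3 a b n = 0"
proof -
  have "X$1 * det3 a b n = det3 (X$1 *\<^sub>R a + X$2 *\<^sub>R b) b n"
    "X$2 * det3 a b n = det3 a (X$1 *\<^sub>R a + X$2 *\<^sub>R b) n"
    by (simp_all add: det3_expand algebra_simps)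
  moreover have "det3 0 b n = 0" "det3 a 0 n = 0" by (simp_all add: det3_expand)
  ultimately have "X$1 * det3 a b n = 0" "X$2 * det3 a b n = 0" using assms(2) by simp_all
  then show ?thesis using assms(1) by (auto simp: vec_eq_iff forall_2)
qed

lemma plane_basis:
  fixes e w Z :: "real^2"
  assumes "e$1 * w$2 - e$2 * w$1 \<noteq> 0"
  obtains a b where "Z = a *\<^sub>R e + b *\<^sub>R w" "b * (e$1 * w$2 - e$2 * w$1) = e$1 * Z$2 - e$2 * Z$1"
proof
  let ?d = "e$1 * w$2 - e$2 * w$1"
  show "Z = ((Z$1 * w$2 - Z$2 * w$1) / ?d) *\<^sub>R e + ((e$1 * Z$2 - e$2 * Z$1) / ?d) *\<^sub>R w"
    using assms by (simp add: vec_eq_iff forall_2 add_divide_distrib[symmetric] nonzero_eq_divide_eq)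
      (simp add: algebra_simps)
  show "((e$1 * Z$2 - e$2 * Z$1) / ?d) * ?d = e$1 * Z$2 - e$2 * Z$1" using assms by simp
qed

lemma plane_parallel:
  fixes e w :: "real^2"
  assumes "e$1 * w$2 - e$2 * w$1 = 0" "e \<noteq> 0"
  obtains k where "w = k *\<^sub>R e"
proof -
  have "w = (if e$1 = 0 then w$2 / e$2 else w$1 / e$1) *\<^sub>R e"
    using assms by (auto simp: vec_eq_iff forall_2 field_simps)
  then show ?thesis using that by blast
qed

section \<open>Fronts\<close>

lemma frechet_derivative_eq_jacobian:
  fixes f :: "real^'n \<Rightarrow> real^'m"
  assumes "f differentiable (at q)"
  shows "frechet_derivative f (at q) = (\<lambda>h. jacobian f (at q) *v h)"
  using assms frechet_derivative_at jacobian_works by metis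

lemma singular_set_iff:
  assumes "smooth_on \<Sigma> f" "open \<Sigma>"
  shows "q \<in> singular_set \<Sigma> f \<longleftrightarrow> q \<in> \<Sigma> \<and> (\<exists>X. X \<noteq> 0 \<and> frechet_derivative f (at q) X = 0)"
proof (cases "q \<in> \<Sigma>")
  case True
  let ?A = "jacobian f (at q)"
  have "f differentiable (at q)"
    using smooth_on_has_derivative[OF assms True] by (auto simp: differentiable_def)
  then have e: "frechet_derivative f (at q) = (\<lambda>h. ?A *v h)" by (rule frechet_derivative_eq_jacobian)
  have "rank ?A \<le> 2" using rank_bound[of ?A] by simp
  then have "rank ?A < 2 \<longleftrightarrow> rank ?A \<noteq> CARD(2)" by auto
  also have "\<dots> \<longleftrightarrow> \<not> inj ((*v) ?A)" unfolding full_rank_injective ..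
  also have "\<dots> \<longleftrightarrow> (\<exists>X. X \<noteq> 0 \<and> ?A *v X = 0)"
    using linear_injective_0[of "(*v) ?A"] by auto
  finally show ?thesis using True unfolding singular_set_def e by simp
qed (simp add: singular_set_def)

locale front_with_gauss_map =
  fixes \<Sigma> :: "(real^2) set" and f \<nu> :: "real^2 \<Rightarrow> real^3"
  assumes open_domain: "open \<Sigma>" and smooth_f: "smooth_on \<Sigma> f" and gauss_map: "is_gauss_map \<Sigma> f \<nu>"
begin

abbreviation "Df q \<equiv> frechet_derivative f (at q)"
abbreviation "D\<nu> q \<equiv> frechet_derivative \<nu> (at q)"

text \<open>The signed area density of \<open>\<nu>\<close>: as \<open>\<nu>\<close> is the unit normal of the sphere at \<open>\<nu>\<close>, this is the Jacobian
  determinant of \<open>\<nu>\<close> as a map into the sphere.\<close>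

definition gauss_density :: "real^2 \<Rightarrow> real" where
  "gauss_density q = det3 (pd 1 \<nu> q) (pd 2 \<nu> q) (\<nu> q)"

lemma smooth_\<nu>: "smooth_on \<Sigma> \<nu>"
  and Df_normal: "q \<in> \<Sigma> \<Longrightarrow> Df q X \<bullet> \<nu> q = 0"
  using gauss_map unfolding is_gauss_map_def by blast+

lemma \<nu>_unit: "q \<in> \<Sigma> \<Longrightarrow> \<nu> q \<bullet> \<nu> q = 1"
  using gauss_map unfolding is_gauss_map_def by (auto simp: dot_square_norm)

lemmas smooth_rules = smooth_f smooth_\<nu> open_domain
lemmas Df = smooth_on_has_derivative[OF smooth_f open_domain]
lemmas D\<nu> = smooth_on_has_derivative[OF smooth_\<nu> open_domain]
lemmas Df_plane = frechet_derivative_plane[OF smooth_on_linear_derivative[OF smooth_f open_domain]]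
lemmas D\<nu>_plane = frechet_derivative_plane[OF smooth_on_linear_derivative[OF smooth_\<nu> open_domain]]

lemma smooth_area_density: "smooth_on \<Sigma> (area_density f \<nu>)"
  and smooth_gauss_density: "smooth_on \<Sigma> gauss_density"
  unfolding area_density_def[abs_def] gauss_density_def[abs_def]
  by (intro smooth_on_det3 smooth_on_pd smooth_rules)+

lemma derivative_of_vanishing:
  assumes "\<And>q. q \<in> \<Sigma> \<Longrightarrow> h q = c" "(h has_derivative h') (at q)" "q \<in> \<Sigma>"
  shows "h' X = 0"
proof -
  have "(h has_derivative (\<lambda>X. 0)) (at q)"
    by (rule has_derivative_transform_within_open[OF has_derivative_const[of c] open_domain assms(3)])
      (simp add: assms(1))
  then have "h' = (\<lambda>X. 0)" by (rule has_derivative_unique[OF assms(2)])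
  then show ?thesis by simp
qed

lemma D\<nu>_normal:
  assumes "q \<in> \<Sigma>"
  shows "D\<nu> q X \<bullet> \<nu> q = 0"
  using derivative_of_vanishing[OF \<nu>_unit has_derivative_inner[OF D\<nu>[OF assms] D\<nu>[OF assms]] assms, of X]
  by (simp add: inner_commute)

text \<open>Differentiating \<open>\<langle>df(u), \<nu>\<rangle> = 0\<close> expresses the second fundamental form through \<open>df\<close> and \<open>d\<nu>\<close>.\<close>

lemma weingarten:
  assumes "q \<in> \<Sigma>"
  shows "frechet_derivative (\<lambda>y. Df y u) (at q) v \<bullet> \<nu> q = - (Df q u \<bullet> D\<nu> q v)"
proof -
  have "((\<lambda>y. Df y u) has_derivative frechet_derivative (\<lambda>y. Df y u) (at q)) (at q)"
    by (rule smooth_on_has_derivative[OF smooth_on_frechet_derivative[OF smooth_f open_domain]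
          open_domain assms])
  from derivative_of_vanishing[OF Df_normal has_derivative_inner[OF this D\<nu>[OF assms]] assms]
  show ?thesis by (simp add: add_eq_0_iff)
qed

lemma second_fundamental_form_symmetric:
  assumes "q \<in> \<Sigma>"
  shows "Df q u \<bullet> D\<nu> q v = Df q v \<bullet> D\<nu> q u"
  using weingarten[OF assms, of u v] weingarten[OF assms, of v u]
    symmetric_second_derivative[OF smooth_f open_domain assms, of u v] by simp

lemma immersed:
  assumes "q \<in> \<Sigma>" "Df q X = 0" "D\<nu> q X = 0"
  shows "X = 0"
proof -
  have "((\<lambda>q. (f q, \<nu> q)) has_derivative (\<lambda>X. (Df q X, D\<nu> q X))) (at q)"
    by (rule has_derivative_Pair[OF Df D\<nu>]) fact+
  then have "frechet_derivative (\<lambda>q. (f q, \<nu> q)) (at q) = (\<lambda>X. (Df q X, D\<nu> q X))"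
    by (rule frechet_derivative_at[symmetric])
  then have i: "inj (\<lambda>X. (Df q X, D\<nu> q X))"
    using gauss_map assms(1) unfolding is_gauss_map_def immersion_on_def by auto
  have "Df q 0 = 0" "D\<nu> q 0 = 0"
    using linear_0[OF smooth_on_linear_derivative[OF smooth_f open_domain assms(1)]]
      linear_0[OF smooth_on_linear_derivative[OF smooth_\<nu> open_domain assms(1)]] .
  then show ?thesis using injD[OF i, of X 0] assms by simp
qed

lemma singular_iff_kernel: "q \<in> singular_set \<Sigma> f \<longleftrightarrow> q \<in> \<Sigma> \<and> (\<exists>X. X \<noteq> 0 \<and> Df q X = 0)"
  by (rule singular_set_iff[OF smooth_f open_domain])

lemma area_density_singular:
  assumes "q \<in> singular_set \<Sigma> f"
  shows "area_density f \<nu> q = 0"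
proof -
  obtain X where "X \<noteq> 0" "Df q X = 0" "q \<in> \<Sigma>" using assms singular_iff_kernel by blast
  then show ?thesis unfolding area_density_def using dependent_imp_det3_eq_0[of X] Df_plane[of q X] by simp
qed

lemma gauss_density_eq_0_imp_kernel:
  assumes "q \<in> \<Sigma>" "gauss_density q = 0"
  obtains X where "X \<noteq> 0" "D\<nu> q X = 0"
proof -
  have "pd i \<nu> q \<bullet> \<nu> q = 0" for i unfolding pd_def by (rule D\<nu>_normal[OF assms(1)])
  then obtain X :: "real^2" where "X \<noteq> 0" "X$1 *\<^sub>R pd 1 \<nu> q + X$2 *\<^sub>R pd 2 \<nu> q = 0"
    using det3_eq_0_imp_dependent[OF \<nu>_unit[OF assms(1)]] assms(2) unfolding gauss_density_def by blast
  then show ?thesis using that D\<nu>_plane[OF assms(1)] by simp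
qed

text \<open>With \<open>L, M, N\<close> and \<open>E, F, G\<close> the coefficients of the fundamental forms, \<open>EG - F\<^sup>2 = \<lambda>\<^sup>2\<close> and
  \<open>LN - M\<^sup>2\<close> is the product of \<open>\<lambda>\<close> and the density of \<open>\<nu>\<close>.\<close>

lemma curvature_times_density:
  assumes "q \<in> \<Sigma>" "area_density f \<nu> q \<noteq> 0"
  shows "gaussian_curvature f \<nu> q * area_density f \<nu> q = gauss_density q"
proof -
  let ?l = "area_density f \<nu> q"
  have w: "pd i (pd j f) q \<bullet> \<nu> q = - (pd j f q \<bullet> pd i \<nu> q)" for i j
    using weingarten[OF assms(1), of "axis j 1" "axis i 1"] unfolding pd_def[abs_def] .
  have s: "pd 2 f q \<bullet> pd 1 \<nu> q = pd 1 f q \<bullet> pd 2 \<nu> q"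
    using second_fundamental_form_symmetric[OF assms(1)] unfolding pd_def .
  have t: "pd i f q \<bullet> \<nu> q = 0" "pd i \<nu> q \<bullet> \<nu> q = 0" for i
    unfolding pd_def using Df_normal D\<nu>_normal assms(1) by blast+
  note m = det3_mult[OF \<nu>_unit[OF assms(1)] t(1)]
  have I: "(pd 1 f q \<bullet> pd 1 f q) * (pd 2 f q \<bullet> pd 2 f q) - (pd 1 f q \<bullet> pd 2 f q)\<^sup>2 = ?l * ?l"
    using m[OF t(1) t(1), of 1 "pd 2 f q" 1 2] unfolding area_density_def
    by (simp add: power2_eq_square inner_commute)
  have II: "(pd 1 (pd 1 f) q \<bullet> \<nu> q) * (pd 2 (pd 2 f) q \<bullet> \<nu> q) - (pd 2 (pd 1 f) q \<bullet> \<nu> q)\<^sup>2 = ?l * gauss_density q"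
    using m[OF t(2) t(2), of 1 "pd 2 f q" 1 2] s unfolding area_density_def gauss_density_def
    unfolding w by (simp add: power2_eq_square inner_commute)
  show ?thesis unfolding gaussian_curvature_def I II using assms(2) by simp
qed

text \<open>Off the singular set the density of \<open>\<nu>\<close> is \<open>K \<lambda>\<close>, which tends to 0 at a singular point that is
  approached through regular points.\<close>

lemma gauss_density_singular:
  assumes U: "open U" "q \<in> U" "U \<subseteq> \<Sigma>" "bounded (gaussian_curvature f \<nu> ` (U - singular_set \<Sigma> f))"
    and q: "q \<in> singular_set \<Sigma> f"
    and pos: "\<forall>\<^sub>F s in at_right 0. area_density f \<nu> (q + s *\<^sub>R w) > 0"
  shows "gauss_density q = 0"
proof -
  obtain C where C: "\<And>y. y \<in> U - singular_set \<Sigma> f \<Longrightarrow> \<bar>gaussian_curvature f \<nu> y\<bar> \<le> C"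
    using U(4) unfolding bounded_iff by auto
  have q\<Sigma>: "q \<in> \<Sigma>" using U by blast
  have line: "((\<lambda>s. q + s *\<^sub>R w) \<longlongrightarrow> q) (at_right 0)"
    by (auto intro!: tendsto_eq_intros)
  have lim: "((\<lambda>s. h (q + s *\<^sub>R w)) \<longlongrightarrow> h q) (at_right 0)" if "smooth_on \<Sigma> h" for h :: "_ \<Rightarrow> real"
    by (rule isCont_tendsto_compose[OF smooth_on_isCont[OF that open_domain q\<Sigma>] line])
  have "\<bar>gauss_density q\<bar> \<le> C * area_density f \<nu> q"
  proof (rule tendsto_le)
    show "((\<lambda>s. C * area_density f \<nu> (q + s *\<^sub>R w)) \<longlongrightarrow> C * area_density f \<nu> q) (at_right 0)"
      by (intro tendsto_mult_left lim smooth_area_density)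
    show "((\<lambda>s. \<bar>gauss_density (q + s *\<^sub>R w)\<bar>) \<longlongrightarrow> \<bar>gauss_density q\<bar>) (at_right 0)"
      by (intro tendsto_rabs lim smooth_gauss_density)
    have "\<forall>\<^sub>F s in at_right 0. q + s *\<^sub>R w \<in> U" using topological_tendstoD[OF line U(1,2)] .
    then show "\<forall>\<^sub>F s in at_right 0. \<bar>gauss_density (q + s *\<^sub>R w)\<bar> \<le> C * area_density f \<nu> (q + s *\<^sub>R w)"
      using pos
    proof eventually_elim
      case (elim s)
      let ?y = "q + s *\<^sub>R w"
      have "?y \<in> U - singular_set \<Sigma> f" using elim area_density_singular[of ?y] by auto
      from C[OF this] show ?case
        using curvature_times_density[of ?y] elim U(3) by (auto simp: abs_mult mult_right_mono
            simp flip: curvature_times_density)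
    qed
  qed simp
  then show ?thesis using area_density_singular[OF q] by simp
qed

text \<open>\<open>df\<close> and \<open>d\<nu>\<close> have kernel vectors, independent since \<open>(f, \<nu>)\<close> is an immersion, and the symmetric
  second fundamental form vanishes against each of them.\<close>

lemma second_fundamental_form_eq_0:
  assumes "q \<in> singular_set \<Sigma> f" "gauss_density q = 0"
  shows "Df q X \<bullet> D\<nu> q Y = 0"
proof -
  obtain e where e: "e \<noteq> 0" "Df q e = 0" "q \<in> \<Sigma>" using assms(1) singular_iff_kernel by blast
  obtain w where w: "w \<noteq> 0" "D\<nu> q w = 0" using gauss_density_eq_0_imp_kernel[OF e(3) assms(2)] .
  note lf = smooth_on_linear_derivative[OF smooth_f open_domain e(3)]
  note ln = smooth_on_linear_derivative[OF smooth_\<nu> open_domain e(3)]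
  have ind: "e$1 * w$2 - e$2 * w$1 \<noteq> 0"
  proof
    assume "e$1 * w$2 - e$2 * w$1 = 0"
    then obtain k where "w = k *\<^sub>R e" using plane_parallel e(1) by blast
    then have "Df q w = 0" using e(2) linear_scale[OF lf] by simp
    then show False using immersed[OF e(3) _ w(2)] w(1) by blast
  qed
  obtain a b where X: "X = a *\<^sub>R e + b *\<^sub>R w" using plane_basis[OF ind] by metis
  obtain c d where Y: "Y = c *\<^sub>R e + d *\<^sub>R w" using plane_basis[OF ind] by metis
  have "Df q X = b *\<^sub>R Df q w" "D\<nu> q Y = c *\<^sub>R D\<nu> q e"
    unfolding X Y using e w by (simp_all add: linear_add[OF lf] linear_scale[OF lf] linear_add[OF ln] linear_scale[OF ln])
  then show ?thesis using second_fundamental_form_symmetric[OF e(3), of w e] e(2) by simp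
qed

end

section \<open>Cuspidal curvature along a spherical curve\<close>

text \<open>All of \<open>a\<close>, \<open>g1\<close>, \<open>g2\<close> are orthogonal to \<open>n\<close>. Multiplying either side by \<open>det(a, g1, n)\<close>, which is non-zero
  since \<open>a\<close> and \<open>g1\<close> are orthogonal, turns it into inner products.\<close>

lemma det3_cusp_relation:
  assumes n: "n \<bullet> n = 1" "g1 \<bullet> n = 0" "g2 \<bullet> n = 0" "a \<bullet> n = 0"
    and ab: "a \<bullet> g1 = 0" "b \<bullet> g1 = - 2 * (a \<bullet> g2)" "g1 \<noteq> 0" "a \<noteq> 0"
  shows "det3 n a b = 2 * (a \<bullet> a) / (g1 \<bullet> g1) * det3 g1 g2 n"
proof -
  define d where "d = det3 a g1 n"
  have dd: "d * d = (a \<bullet> a) * (g1 \<bullet> g1)"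
    using det3_mult[OF n(1,4,4,2), of g1] ab(1) by (simp add: d_def inner_commute)
  then have d: "d \<noteq> 0" using ab(3,4) by auto
  have 1: "det3 a b n * d = 2 * (a \<bullet> a) * (a \<bullet> g2) * -1"
    using det3_mult[OF n(1,4,4,2), of b] ab(1,2) by (simp add: d_def algebra_simps)
  have 2: "d * det3 g1 g2 n = - (a \<bullet> g2) * (g1 \<bullet> g1)"
    using det3_mult[OF n(1,4,2,3), of g1] ab(1) by (simp add: d_def)
  have "(det3 a b n * (g1 \<bullet> g1)) * d = (det3 a b n * d) * (g1 \<bullet> g1)" by (simp only: mult_ac)
  also have "\<dots> = 2 * (a \<bullet> a) * (- (a \<bullet> g2) * (g1 \<bullet> g1))" unfolding 1 by simp
  also have "\<dots> = (2 * (a \<bullet> a) * det3 g1 g2 n) * d" unfolding 2[symmetric] by (simp only: mult_ac)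
  finally have "(det3 a b n * (g1 \<bullet> g1)) * d = (2 * (a \<bullet> a) * det3 g1 g2 n) * d" .
  then have "det3 a b n * (g1 \<bullet> g1) = 2 * (a \<bullet> a) * det3 g1 g2 n" using d by simp
  then show ?thesis using ab(3) by (simp add: det3_cyclic[of n a b] field_simps)
qed

text \<open>Where \<open>c' = 0\<close>, the relation \<open>\<langle>c', g'\<rangle> = 0\<close> differentiated once shows that \<open>c''\<close> is orthogonal to \<open>g'\<close>, and
  differentiated twice that \<open>\<langle>c''', g'\<rangle> = -2 \<langle>c'', g''\<rangle>\<close>. So the component of \<open>c'''\<close> that makes the cusp turn is
  dictated by the bending of \<open>g\<close>. The covariant derivatives differ from the ordinary ones by multiples of
  \<open>c\<close>, which the determinant ignores.\<close>

lemma cuspidal_curvature_orthogonal_curve: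
  fixes c g :: "real \<Rightarrow> real^3"
  assumes c: "smooth_on I c" and g: "smooth_on I g" and I: "open I" "t\<^sub>0 \<in> I"
    and unit: "\<And>t. t \<in> I \<Longrightarrow> c t \<bullet> c t = 1"
    and tangent: "\<And>t. t \<in> I \<Longrightarrow> vector_derivative g (at t) \<bullet> c t = 0"
    and orth: "\<And>t. t \<in> I \<Longrightarrow> vector_derivative g (at t) \<bullet> vector_derivative c (at t) = 0"
    and c0: "vector_derivative c (at t\<^sub>0) = 0"
    and c2: "vector_derivative (\<lambda>t. vector_derivative c (at t)) (at t\<^sub>0) \<noteq> 0"
    and g0: "vector_derivative g (at t\<^sub>0) \<noteq> 0"
  shows "\<exists>m>0. cuspidal_curvature c t\<^sub>0 = m *
    det3 (vector_derivative g (at t\<^sub>0)) (vector_derivative (\<lambda>t. vector_derivative g (at t)) (at t\<^sub>0)) (c t\<^sub>0)"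
proof -
  define c' where "c' t = vector_derivative c (at t)" for t
  define c'' where "c'' t = vector_derivative c' (at t)" for t
  define c3 where "c3 = vector_derivative c'' (at t\<^sub>0)"
  define g' where "g' t = vector_derivative g (at t)" for t
  define g'' where "g'' t = vector_derivative g' (at t)" for t
  define g3 where "g3 = vector_derivative g'' (at t\<^sub>0)"
  note sm = c g smooth_on_vector_derivative[OF c I(1), folded c'_def]
    smooth_on_vector_derivative[OF g I(1), folded g'_def]
  note sm2 = smooth_on_vector_derivative[OF sm(3) I(1), folded c''_def]
    smooth_on_vector_derivative[OF sm(4) I(1), folded g''_def]
  note vd = sm[THEN smooth_on_has_vector_derivative, OF I(1)]
  have d: "(c has_vector_derivative c' t) (at t)" "(g has_vector_derivative g' t) (at t)"
    "(c' has_vector_derivative c'' t) (at t)" "(g' has_vector_derivative g'' t) (at t)" if "t \<in> I" for t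
    using vd[OF that] unfolding c'_def[symmetric] g'_def[symmetric] c''_def[symmetric] g''_def[symmetric]
    by blast+
  have d2: "(c'' has_vector_derivative c3) (at t\<^sub>0)" "(g'' has_vector_derivative g3) (at t\<^sub>0)"
    using sm2[THEN smooth_on_has_vector_derivative, OF I] unfolding c3_def g3_def by blast+
  have zero: "h' = 0" if "(h has_vector_derivative h') (at t)" "\<And>s. s \<in> I \<Longrightarrow> h s = k" "t \<in> I"
    for h :: "real \<Rightarrow> real" and h' k t
  proof -
    have "(h has_vector_derivative 0) (at t)"
      by (rule has_vector_derivative_transform_within_open[OF has_vector_derivative_const[of k] I(1) that(3)])
        (simp add: that(2))
    then show ?thesis using that(1) vector_derivative_unique_at by blast
  qed
  note ip = bounded_bilinear.has_vector_derivative[OF bounded_bilinear_inner]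
  have cc': "c t \<bullet> c' t = 0" if "t \<in> I" for t
    using zero[OF ip[OF d(1)[OF that] d(1)[OF that]] unit that] by (simp add: inner_commute)
  have 1: "c'' t\<^sub>0 \<bullet> c t\<^sub>0 = 0"
    using zero[OF ip[OF d(1)[OF I(2)] d(3)[OF I(2)]] cc' I(2)] c0 by (simp add: c'_def[symmetric] inner_commute)
  have 2: "g'' t\<^sub>0 \<bullet> c t\<^sub>0 = 0"
    using zero[OF ip[OF d(4)[OF I(2)] d(1)[OF I(2)]] tangent[folded g'_def] I(2)] c0
    by (simp add: c'_def[symmetric])
  have 3: "g' t \<bullet> c'' t + g'' t \<bullet> c' t = 0" if "t \<in> I" for t
    using zero[OF ip[OF d(4)[OF that] d(3)[OF that]] orth[folded g'_def c'_def] that] .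
  have "g' t\<^sub>0 \<bullet> c3 + g'' t\<^sub>0 \<bullet> c'' t\<^sub>0 + (g'' t\<^sub>0 \<bullet> c'' t\<^sub>0 + g3 \<bullet> c' t\<^sub>0) = 0"
    by (rule zero[OF has_vector_derivative_add[OF ip[OF d(4)[OF I(2)] d2(1)] ip[OF d2(2) d(3)[OF I(2)]]] 3 I(2)])
  then have 4: "c3 \<bullet> g' t\<^sub>0 = - 2 * (c'' t\<^sub>0 \<bullet> g'' t\<^sub>0)"
    using c0 by (simp add: c'_def[symmetric] inner_commute)
  have 5: "c'' t\<^sub>0 \<bullet> g' t\<^sub>0 = 0" using 3[OF I(2)] c0 by (simp add: c'_def[symmetric] inner_commute)
  define a where "a = cov_deriv c (\<lambda>t. vector_derivative c (at t))"
  have a: "a = (\<lambda>t. c'' t - (c'' t \<bullet> c t) *\<^sub>R c t)"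
    unfolding a_def cov_deriv_def c''_def c'_def by (simp add: fun_eq_iff)
  have a0: "a t\<^sub>0 = c'' t\<^sub>0" using 1 by (simp add: a)
  define k where "k = c'' t\<^sub>0 \<bullet> c' t\<^sub>0 + c3 \<bullet> c t\<^sub>0"
  have "(a has_vector_derivative c3 - k *\<^sub>R c t\<^sub>0) (at t\<^sub>0)"
    unfolding a k_def using has_vector_derivative_diff[OF d2(1)
        bounded_bilinear.has_vector_derivative[OF bounded_bilinear_scaleR ip[OF d2(1) d(1)[OF I(2)]] d(1)[OF I(2)]]] 1
    by simp
  then have a': "vector_derivative a (at t\<^sub>0) = c3 - k *\<^sub>R c t\<^sub>0" by (rule vector_derivative_at)
  have "det3 (c t\<^sub>0) (a t\<^sub>0) (cov_deriv c a t\<^sub>0) = det3 (c t\<^sub>0) (c'' t\<^sub>0) c3"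
    unfolding a0 cov_deriv_def a' by (simp add: det3_expand algebra_simps)
  also have "\<dots> = 2 * (c'' t\<^sub>0 \<bullet> c'' t\<^sub>0) / (g' t\<^sub>0 \<bullet> g' t\<^sub>0) * det3 (g' t\<^sub>0) (g'' t\<^sub>0) (c t\<^sub>0)"
    by (rule det3_cusp_relation[OF unit[OF I(2)] tangent[OF I(2), folded g'_def] 2 1 5 4])
      (use g0 c2 in \<open>simp_all add: g'_def c''_def c'_def[abs_def]\<close>)
  finally have "cuspidal_curvature c t\<^sub>0 = (2 * (c'' t\<^sub>0 \<bullet> c'' t\<^sub>0) / (g' t\<^sub>0 \<bullet> g' t\<^sub>0) / norm (c'' t\<^sub>0) powr (5/2)) *
      det3 (g' t\<^sub>0) (g'' t\<^sub>0) (c t\<^sub>0)"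
    unfolding cuspidal_curvature_def Let_def a_def[symmetric] a0 by simp
  moreover have "0 < 2 * (c'' t\<^sub>0 \<bullet> c'' t\<^sub>0) / (g' t\<^sub>0 \<bullet> g' t\<^sub>0) / norm (c'' t\<^sub>0) powr (5/2)"
    using g0 c2 unfolding g'_def c''_def c'_def[abs_def] by simp
  ultimately show ?thesis unfolding g''_def g'_def[abs_def] by blast
qed


section \<open>The cusp of the Gauss map\<close>

lemma has_vector_derivative_vec2:
  assumes "(a has_real_derivative a') (at t)" "(b has_real_derivative b') (at t)"
  shows "((\<lambda>t. vector [a t, b t] :: real^2) has_vector_derivative vector [a', b']) (at t)"
proof -
  have *: "vector [s, r] = s *\<^sub>R axis 1 1 + r *\<^sub>R (axis 2 1 :: real^2)" for s r :: real
    by (simp add: vec_eq_iff forall_2 axis_def)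
  show ?thesis unfolding *
    by (rule has_vector_derivative_eq_rhs[OF has_vector_derivative_add[OF
            has_vector_derivative_scaleR[OF assms(1) has_vector_derivative_const]
            has_vector_derivative_scaleR[OF assms(2) has_vector_derivative_const]]]) simp
qed

lemma has_vector_derivative_vec3:
  assumes "(a has_real_derivative a') (at t)" "(b has_real_derivative b') (at t)"
    "(c has_real_derivative c') (at t)"
  shows "((\<lambda>t. vector [a t, b t, c t] :: real^3) has_vector_derivative vector [a', b', c']) (at t)"
proof -
  have *: "vector [s, r, q] = s *\<^sub>R axis 1 1 + r *\<^sub>R axis 2 1 + q *\<^sub>R (axis 3 1 :: real^3)" for s r q :: real
    by (simp add: vec_eq_iff forall_3 axis_def)
  show ?thesis unfolding *
    by (rule has_vector_derivative_eq_rhs[OF has_vector_derivative_add[OF has_vector_derivative_add[OF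
            has_vector_derivative_scaleR[OF assms(1) has_vector_derivative_const]
            has_vector_derivative_scaleR[OF assms(2) has_vector_derivative_const]]
            has_vector_derivative_scaleR[OF assms(3) has_vector_derivative_const]]]) simp
qed

lemma vector_derivative_cong_open:
  assumes "open S" "t \<in> S" "\<And>s. s \<in> S \<Longrightarrow> f s = g s"
  shows "vector_derivative f (at t) = vector_derivative g (at t)"
proof -
  have "(f has_vector_derivative D) (at t) \<longleftrightarrow> (g has_vector_derivative D) (at t)" for D
    using has_vector_derivative_transform_within_open[OF _ assms(1,2), of f D g]
      has_vector_derivative_transform_within_open[OF _ assms(1,2), of g D f] assms(3) by auto
  then show ?thesis by (simp add: vector_derivative_def)
qed

lemma open_real_nbhd_interval:
  fixes S :: "real set"
  assumes "open S" "0 \<in> S"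
  obtains d where "0 < d" "{-d<..<d} \<subseteq> S"
proof -
  obtain d where "0 < d" "ball 0 d \<subseteq> S" using assms open_contains_ball by blast
  moreover have "ball 0 d = {-d<..<d}" by (auto simp: dist_real_def)
  ultimately show ?thesis using that by simp
qed

lemma smooth_on_real_derivative:
  fixes v :: "real \<Rightarrow> real"
  shows "smooth_on S v \<Longrightarrow> open S \<Longrightarrow> t \<in> S \<Longrightarrow> (v has_real_derivative vector_derivative v (at t)) (at t)"
  using smooth_on_has_vector_derivative by (simp add: has_real_derivative_iff_has_vector_derivative)

definition cusp_model :: "real^2 \<Rightarrow> real^2" where
  "cusp_model w = vector [w$1, (w$2)^3 + w$1 * w$2]"

lemma smooth_cusp_model: "smooth_on UNIV cusp_model"
  unfolding cusp_model_def[abs_def]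
  by (intro smooth_on_vec2I smooth_on_add smooth_on_mult smooth_on_power smooth_on_component
      smooth_on_ident open_UNIV)

lemma cusp_model_kernel:
  assumes "frechet_derivative cusp_model (at w) Y = 0" "Y \<noteq> 0"
  shows "w$1 = - 3 * (w$2)\<^sup>2"
proof -
  have c: "((\<lambda>w::real^2. w $ i) has_derivative (\<lambda>X. X $ i)) (at w)" for i
    by (rule bounded_linear.has_derivative[OF bounded_linear_vec_nth has_derivative_ident])
  have d: "((\<lambda>w. cusp_model w $ i) has_derivative (\<lambda>X. frechet_derivative cusp_model (at w) X $ i)) (at w)" for i
    by (rule bounded_linear.has_derivative[OF bounded_linear_vec_nth
          smooth_on_has_derivative[OF smooth_cusp_model open_UNIV UNIV_I]])
  have "((\<lambda>w. cusp_model w $ 1) has_derivative (\<lambda>X. X $ 1)) (at w)"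
    unfolding cusp_model_def by (simp add: c)
  from has_derivative_unique[OF this d] have Y1: "Y $ 1 = 0" using assms(1) by (metis zero_index)
  have "((\<lambda>w::real^2. (w$2)^3 + w$1 * w$2) has_derivative
      (\<lambda>X. 3 * X$2 * (w$2)\<^sup>2 + (w$1 * X$2 + X$1 * w$2))) (at w)"
    by (rule has_derivative_eq_rhs[OF has_derivative_add[OF has_derivative_power[OF c]
            has_derivative_mult[OF c c]]]) (simp add: mult_ac)
  then have "((\<lambda>w. cusp_model w $ 2) has_derivative
      (\<lambda>X. 3 * X$2 * (w$2)\<^sup>2 + (w$1 * X$2 + X$1 * w$2))) (at w)"
    unfolding cusp_model_def by simp
  from has_derivative_unique[OF this d]
  have "3 * Y$2 * (w$2)\<^sup>2 + (w$1 * Y$2 + Y$1 * w$2) = 0" using assms(1) by (metis zero_index)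
  then have "Y$2 * (3 * (w$2)\<^sup>2 + w$1) = 0" using Y1 by (simp add: algebra_simps)
  moreover have "Y$2 \<noteq> 0" using assms(2) Y1 by (auto simp: vec_eq_iff forall_2)
  ultimately show ?thesis by simp
qed

text \<open>In the normal form of the cusp the singular points of \<open>\<nu>\<close> form the parabola \<open>(-3 v\<^sup>2, v)\<close>, whose
  image is \<open>(-3 v\<^sup>2, -2 v\<^sup>3)\<close>. A regular curve of singular points is this parabola up to a change of
  parameter, since \<open>v\<close> is a local coordinate on it.\<close>

lemma gauss_map_cusp_along_singular_curve:
  assumes \<Sigma>: "open \<Sigma>" and \<nu>: "smooth_on \<Sigma> \<nu>" and cusp: "gauss_map_cusp \<Sigma> \<nu> p"
    and \<gamma>: "0 < \<epsilon>" "smooth_on {-\<epsilon><..<\<epsilon>} \<gamma>" "\<gamma> 0 = p" "vector_derivative \<gamma> (at 0) \<noteq> 0"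
    and O: "open O'" "p \<in> O'"
    and ker: "\<And>t. t \<in> {-\<epsilon><..<\<epsilon>} \<Longrightarrow> \<gamma> t \<in> O' \<Longrightarrow> \<exists>X. X \<noteq> 0 \<and> frechet_derivative \<nu> (at (\<gamma> t)) X = 0"
  shows "ordinary_cusp {-\<epsilon><..<\<epsilon>} (\<nu> \<circ> \<gamma>) 0"
    and "vector_derivative (\<nu> \<circ> \<gamma>) (at 0) = 0"
    and "vector_derivative (\<lambda>t. vector_derivative (\<nu> \<circ> \<gamma>) (at t)) (at 0) \<noteq> 0"
proof -
  let ?I = "{-\<epsilon><..<\<epsilon>}"
  have cusp': "A_equivalent \<Sigma> S2 \<nu> p UNIV UNIV cusp_model 0"
    using cusp unfolding gauss_map_cusp_def cusp_model_def[abs_def] .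
  obtain U V W Z \<phi> \<psi> \<Phi> \<Psi> where U: "open U" "U \<subseteq> \<Sigma>" "p \<in> U" and V: "open V" "0 \<in> V"
    and \<phi>: "homeomorphism U V \<phi> \<psi>" "smooth_on U \<phi>" "smooth_on V \<psi>" "\<phi> p = 0"
    and W: "openin (top_of_set S2) W" "open Z"
    and \<Phi>: "homeomorphism W Z \<Phi> \<Psi>" "smooth_on W \<Phi>" "smooth_on Z \<Psi>"
    and im: "\<nu> ` U \<subseteq> W" "cusp_model ` V \<subseteq> Z" and nf: "\<And>q. q \<in> U \<Longrightarrow> \<nu> q = \<Psi> (cusp_model (\<phi> q))"
    using A_equivalent_normal_form[OF cusp' \<Sigma>] by metis
  have \<Psi>inj: "Y = 0" if "z \<in> Z" "frechet_derivative \<Psi> (at z) Y = 0" for z Y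
    by (rule smooth_left_inverse_derivative_inj[OF \<Phi>(3) W(2) \<Phi>(2) _ _ that])
      (use \<Phi>(1) in \<open>auto simp: homeomorphism_def\<close>)
  have \<phi>inj: "Y = 0" if "q \<in> U" "frechet_derivative \<phi> (at q) Y = 0" for q Y
    by (rule smooth_left_inverse_derivative_inj[OF \<phi>(2) U(1) \<phi>(3) _ _ that])
      (use \<phi>(1) in \<open>auto simp: homeomorphism_def\<close>)
  have \<phi>V: "\<phi> q \<in> V" if "q \<in> U" for q using \<phi>(1) that unfolding homeomorphism_def by blast
  have oI: "open ?I" and I0: "0 \<in> ?I" using \<gamma>(1) by auto

  \<comment> \<open>Where \<open>d\<nu>\<close> has a kernel, so has the derivative of the normal form.\<close>
  have parabola: "\<phi> q $ 1 = - 3 * (\<phi> q $ 2)\<^sup>2" if q: "q \<in> U" and X: "X \<noteq> 0" "frechet_derivative \<nu> (at q) X = 0"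
    for q X
  proof -
    have "smooth_on V cusp_model" by (rule smooth_on_subset[OF smooth_cusp_model]) simp
    then have s: "smooth_on U (\<lambda>q. cusp_model (\<phi> q))"
      using smooth_on_compose[OF \<phi>(2)] \<phi>V by blast
    have z: "cusp_model (\<phi> q) \<in> Z" using im(2) \<phi>V[OF q] by blast
    have "\<nu> differentiable (at q)"
      using smooth_on_has_derivative[OF \<nu> \<Sigma>, of q] U(2) q by (auto simp: differentiable_def)
    from frechet_derivative_transform_within_open[OF this U(1) q nf]
    have "0 = frechet_derivative (\<lambda>q. \<Psi> (cusp_model (\<phi> q))) (at q) X"
      using X(2) by simp
    also have "\<dots> = frechet_derivative \<Psi> (at (cusp_model (\<phi> q))) (frechet_derivative (\<lambda>q. cusp_model (\<phi> q)) (at q) X)"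
      by (rule smooth_on_chain[OF s U(1) \<Phi>(3) W(2) q z])
    finally have "frechet_derivative (\<lambda>q. cusp_model (\<phi> q)) (at q) X = 0" using \<Psi>inj[OF z] by simp
    then have "frechet_derivative cusp_model (at (\<phi> q)) (frechet_derivative \<phi> (at q) X) = 0"
      using smooth_on_chain[OF \<phi>(2) U(1) smooth_cusp_model open_UNIV q UNIV_I, of X] by simp
    moreover have "frechet_derivative \<phi> (at q) X \<noteq> 0" using \<phi>inj[OF q] X(1) by blast
    ultimately show ?thesis using cusp_model_kernel by blast
  qed
  define J0 where "J0 = ?I \<inter> \<gamma> -` (U \<inter> O')"
  have J0: "open J0" "0 \<in> J0"
    unfolding J0_def
    using continuous_open_preimage[OF smooth_on_imp_continuous_on[OF \<gamma>(2) oI] oI open_Int[OF U(1) O(1)]]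
      U(3) O(2) \<gamma>(3) I0 by simp_all
  define v where "v t = \<phi> (\<gamma> t) $ 2" for t
  have s\<phi>\<gamma>: "smooth_on J0 (\<lambda>t. \<phi> (\<gamma> t))"
    by (rule smooth_on_compose[OF smooth_on_subset[OF \<gamma>(2)] \<phi>(2)]) (auto simp: J0_def)
  have sv: "smooth_on J0 v" unfolding v_def[abs_def] by (rule smooth_on_component[OF s\<phi>\<gamma>])
  have \<phi>\<gamma>: "\<phi> (\<gamma> t) = vector [- 3 * (v t)\<^sup>2, v t]" if "t \<in> J0" for t
    using that ker parabola[of "\<gamma> t"] by (force simp: J0_def v_def vec_eq_iff forall_2)
  have v0: "v 0 = 0" by (simp add: v_def \<gamma>(3) \<phi>(4))
  have dv: "(v has_real_derivative vector_derivative v (at t)) (at t)" if "t \<in> J0" for t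
    by (rule smooth_on_real_derivative[OF sv J0(1) that])
  have v'0: "vector_derivative v (at 0) \<noteq> 0"
  proof
    assume 0: "vector_derivative v (at 0) = 0"
    have "((\<lambda>t. vector [- 3 * (v t)\<^sup>2, v t] :: real^2) has_vector_derivative vector [0, 0]) (at 0)"
      using dv[OF J0(2)] v0 0 by (intro has_vector_derivative_vec2) (auto intro!: derivative_eq_intros)
    then have "((\<lambda>t. \<phi> (\<gamma> t)) has_vector_derivative vector [0, 0]) (at 0)"
      by (rule has_vector_derivative_transform_within_open[OF _ J0]) (simp add: \<phi>\<gamma>)
    moreover have "((\<lambda>t. \<phi> (\<gamma> t)) has_vector_derivative
        frechet_derivative \<phi> (at (\<gamma> 0)) (vector_derivative \<gamma> (at 0))) (at 0)"
      by (rule smooth_on_chain_curve[OF \<gamma>(2) oI \<phi>(2) U(1) I0]) (simp add: \<gamma>(3) U(3))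
    ultimately have "frechet_derivative \<phi> (at (\<gamma> 0)) (vector_derivative \<gamma> (at 0)) = vector [0, 0]"
      using vector_derivative_unique_at by blast
    also have "\<dots> = 0" by (simp add: vec_eq_iff forall_2)
    finally show False using \<phi>inj[of "\<gamma> 0"] \<gamma>(3,4) U(3) by auto
  qed
  have sv': "smooth_on J0 (\<lambda>t. vector_derivative v (at t))" by (rule smooth_on_vector_derivative[OF sv J0(1)])
  have "open (J0 \<inter> (\<lambda>t. vector_derivative v (at t)) -` (- {0}))"
    by (rule continuous_open_preimage[OF smooth_on_imp_continuous_on[OF sv' J0(1)] J0(1)]) auto
  moreover have "0 \<in> J0 \<inter> (\<lambda>t. vector_derivative v (at t)) -` (- {0})" using J0 v'0 by simp
  ultimately obtain d where d: "0 < d" "{-d<..<d} \<subseteq> J0 \<inter> (\<lambda>t. vector_derivative v (at t)) -` (- {0})"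
    by (rule open_real_nbhd_interval)
  define J where "J = {-d<..<d}"
  have J: "J \<subseteq> J0" "open J" "0 \<in> J" "J \<subseteq> ?I" and v': "\<And>t. t \<in> J \<Longrightarrow> vector_derivative v (at t) \<noteq> 0"
    using d unfolding J_def J0_def by auto
  have svJ: "smooth_on J v" by (rule smooth_on_subset[OF sv J(1)])
  define k where "k t = (vector [- 3 * (v t)\<^sup>2, - 2 * (v t)^3] :: real^2)" for t
  have cf: "cusp_model (\<phi> (\<gamma> t)) = k t" if "t \<in> J" for t
    using \<phi>\<gamma>[of t] that J(1) by (auto simp: cusp_model_def k_def vec_eq_iff forall_2 power2_eq_square power3_eq_cube)
  have c: "(\<nu> \<circ> \<gamma>) t = \<Psi> (k t)" and kZ: "k t \<in> Z" and \<gamma>U: "\<gamma> t \<in> U" if "t \<in> J" for t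
    using that J(1) nf[of "\<gamma> t"] cf[OF that] im(2) \<phi>V[of "\<gamma> t"] unfolding J0_def by auto (use im(2) in force)+
  have sk: "smooth_on J k" unfolding k_def[abs_def]
    by (intro smooth_on_vec2I smooth_on_mult smooth_on_power smooth_on_const svJ J(2))
  define v1 where "v1 t = vector_derivative v (at t)" for t
  have dk: "(k has_vector_derivative vector [- 6 * v t * v1 t, - 6 * (v t)\<^sup>2 * v1 t]) (at t)"
    if "t \<in> J" for t
    unfolding k_def[abs_def] using dv[of t] that J(1) unfolding v1_def
    by (intro has_vector_derivative_vec2) (auto intro!: derivative_eq_intros)
  have k1: "vector_derivative k (at t) = vector [- 6 * v t * v1 t, - 6 * (v t)\<^sup>2 * v1 t]"
    if "t \<in> J" for t
    using vector_derivative_at[OF dk[OF that]] .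
  have k10: "vector_derivative k (at 0) = 0" using k1[OF J(3)] v0 by (simp add: vec_eq_iff forall_2)
  have dv1: "(v1 has_real_derivative vector_derivative v1 (at 0)) (at 0)"
    using smooth_on_real_derivative[OF sv' J0] unfolding v1_def[abs_def] .
  have "((\<lambda>t. vector [- 6 * v t * v1 t, - 6 * (v t)\<^sup>2 * v1 t] :: real^2) has_vector_derivative
      vector [- 6 * (v1 0)\<^sup>2, 0]) (at 0)"
    using dv[OF J0(2), folded v1_def] dv1 v0
    by (intro has_vector_derivative_vec2) (auto intro!: derivative_eq_intros simp: power2_eq_square)
  then have "((\<lambda>t. vector_derivative k (at t)) has_vector_derivative vector [- 6 * (v1 0)\<^sup>2, 0]) (at 0)"
    by (rule has_vector_derivative_transform_within_open[OF _ J(2,3)]) (simp add: k1)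
  then have k2: "vector_derivative (\<lambda>t. vector_derivative k (at t)) (at 0) = vector [- 6 * (v1 0)\<^sup>2, 0]"
    by (rule vector_derivative_at)
  note st = second_derivative_at_stationary_point[OF sk J(2) \<Phi>(3) W(2) _ J(3) k10]
  have c1: "vector_derivative (\<nu> \<circ> \<gamma>) (at t) = vector_derivative (\<lambda>t. \<Psi> (k t)) (at t)" if "t \<in> J" for t
    by (rule vector_derivative_cong_open[OF J(2) that c])
  show "vector_derivative (\<nu> \<circ> \<gamma>) (at 0) = 0" using c1[OF J(3)] st(1) kZ by auto
  have "vector_derivative (\<lambda>t. vector_derivative (\<nu> \<circ> \<gamma>) (at t)) (at 0) =
      vector_derivative (\<lambda>t. vector_derivative (\<lambda>t. \<Psi> (k t)) (at t)) (at 0)"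
    by (rule vector_derivative_cong_open[OF J(2,3) c1])
  also have "\<dots> = frechet_derivative \<Psi> (at (k 0)) (vector [- 6 * (v1 0)\<^sup>2, 0])"
    using st(2) kZ k2 by auto
  also have "\<dots> \<noteq> 0"
  proof
    assume "frechet_derivative \<Psi> (at (k 0)) (vector [- 6 * (v1 0)\<^sup>2, 0]) = 0"
    from \<Psi>inj[OF kZ[OF J(3)] this] show False using v'0 by (simp add: vec_eq_iff forall_2 v1_def)
  qed
  finally show "vector_derivative (\<lambda>t. vector_derivative (\<nu> \<circ> \<gamma>) (at t)) (at 0) \<noteq> 0" .

  \<comment> \<open>The target is rescaled from \<open>(-3 v\<^sup>2, -2 v\<^sup>3)\<close> to \<open>(v\<^sup>2, v\<^sup>3)\<close>.\<close>
  define L where "L z = (vector [- (1/3) * z$1, - (1/2) * z$2] :: real^2)" for z :: "real^2"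
  define M where "M z = (vector [- 3 * z$1, - 2 * z$2] :: real^2)" for z :: "real^2"
  have LM: "L (M z) = z" "M (L z) = z" for z by (simp_all add: L_def M_def vec_eq_iff forall_2)
  have sL: "smooth_on UNIV L" "smooth_on UNIV M" unfolding L_def[abs_def] M_def[abs_def]
    by (intro smooth_on_vec2I smooth_on_mult smooth_on_const smooth_on_component smooth_on_ident open_UNIV)+
  note cL = sL[THEN smooth_on_imp_continuous_on, OF open_UNIV]
  define Z' where "Z' = M -` Z"
  have oZ': "open Z'" unfolding Z'_def using continuous_open_preimage[OF cL(2) open_UNIV W(2)] by simp
  have hL: "homeomorphism Z Z' L M"
  proof (rule homeomorphismI)
    show "continuous_on Z L" "continuous_on Z' M" using cL continuous_on_subset by blast+
  qed (auto simp: Z'_def LM)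
  have dW: "diffeo_between W Z' (L \<circ> \<Phi>)"
    unfolding diffeo_between_def
  proof (intro exI conjI)
    show "homeomorphism W Z' (L \<circ> \<Phi>) (\<Psi> \<circ> M)" by (rule homeomorphism_compose[OF \<Phi>(1) hL])
    show "smooth_on W (L \<circ> \<Phi>)" unfolding o_def by (rule smooth_on_compose[OF \<Phi>(2) sL(1)]) simp
    show "smooth_on Z' (\<Psi> \<circ> M)" unfolding o_def
      by (rule smooth_on_compose[OF smooth_on_subset[OF sL(2)] \<Phi>(3)]) (auto simp: Z'_def)
  qed
  have Lk: "L (k t) = vector [(v t)\<^sup>2, (v t)^3]" for t by (simp add: L_def k_def vec_eq_iff forall_2)
  note diff = smooth_real_diffeo[OF svJ[unfolded J_def] v'[unfolded J_def], folded J_def]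
  show "ordinary_cusp ?I (\<nu> \<circ> \<gamma>) 0"
    unfolding ordinary_cusp_def A_equivalent_def subtopology_UNIV open_openin[symmetric]
  proof (intro exI conjI ballI)
    show "openin (top_of_set ?I) J" by (rule open_subset[OF J(4,2)])
    show "0 \<in> J" "openin (top_of_set S2) W" "open Z'" "v 0 = 0" "diffeo_between W Z' (L \<circ> \<Phi>)"
      by (rule J(3) W(1) oZ' v0 dW)+
    show "open (v ` J)" by (rule diff(1))
    show "diffeo_between J (v ` J) v" by (rule diff(2))
    show "0 \<in> v ` J" using v0 J(3) by force
    show "(\<nu> \<circ> \<gamma>) ` J \<subseteq> W" using im(1) \<gamma>U by auto
    show "(\<lambda>t. vector [t\<^sup>2, t ^ 3]) ` v ` J \<subseteq> Z'"
    proof clarify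
      fix t assume "t \<in> J"
      then show "vector [(v t)\<^sup>2, v t ^ 3] \<in> Z'" using kZ LM(2)[of "k t"] unfolding Lk Z'_def by simp
    qed
    show "(L \<circ> \<Phi>) ((\<nu> \<circ> \<gamma>) t) = vector [(v t)\<^sup>2, v t ^ 3]" if "t \<in> J" for t
      using c[OF that] homeomorphism_apply2[OF \<Phi>(1) kZ[OF that]] Lk[of t] by simp
  qed
qed


section \<open>Adapted coordinates\<close>

lemma det_jacobian_plane:
  "det (jacobian x (at w)) = pd 1 x w $ 1 * pd 2 x w $ 2 - pd 1 x w $ 2 * pd 2 x w $ 1"
  for x :: "real^2 \<Rightarrow> real^2"
  by (simp add: jacobian_def matrix_def det_2 pd_def)

lemma pd_along_axis:
  assumes "smooth_on V G" "open V" "s *\<^sub>R axis i 1 \<in> V"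
  shows "((\<lambda>s. G (s *\<^sub>R axis i 1)) has_vector_derivative pd i G (s *\<^sub>R axis i 1)) (at s)"
proof -
  have "((\<lambda>s. s *\<^sub>R (axis i 1 :: real^2)) has_vector_derivative axis i 1) (at s)"
    by (rule has_vector_derivative_eq_rhs[OF has_vector_derivative_scaleR[OF DERIV_ident has_vector_derivative_const]]) simp
  from vector_derivative_diff_chain_within[OF this has_derivative_at_withinI[OF smooth_on_has_derivative[OF assms]]]
  show ?thesis by (simp add: o_def pd_def)
qed

definition cuspidal_edge_model :: "real^2 \<Rightarrow> real^3" where
  "cuspidal_edge_model w = vector [w$1, (w$2)^2, (w$2)^3]"

text \<open>The reflection \<open>(u, v) \<mapsto> (u, \<sigma> v)\<close> with \<open>\<sigma> = \<plusminus>1\<close> adjusts the orientation of a chart and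
  keeps the \<open>u\<close>-axis and its null direction.\<close>

definition flip :: "real \<Rightarrow> real^2 \<Rightarrow> real^2" where
  "flip \<sigma> w = vector [w$1, \<sigma> * w$2]"

lemma flip_flip: "\<sigma> * \<sigma> = 1 \<Longrightarrow> flip \<sigma> (flip \<sigma> w) = w"
  by (simp add: flip_def vec_eq_iff forall_2 mult.assoc[symmetric])

lemma bounded_linear_flip: "bounded_linear (flip \<sigma>)"
  unfolding linear_conv_bounded_linear[symmetric]
  by (rule linearI) (simp_all add: flip_def vec_eq_iff forall_2 algebra_simps)

definition flipped_model :: "real \<Rightarrow> real^2 \<Rightarrow> real^3" where
  "flipped_model \<sigma> w = cuspidal_edge_model (flip \<sigma> w)"

lemma smooth_flipped_model: "smooth_on UNIV (flipped_model \<sigma>)"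
  unfolding flipped_model_def[abs_def] cuspidal_edge_model_def flip_def
  by (simp, intro smooth_on_vec3I smooth_on_mult smooth_on_power smooth_on_component smooth_on_const
      smooth_on_ident open_UNIV)

lemma flipped_model_derivative:
  "frechet_derivative (flipped_model \<sigma>) (at w) Y =
    vector [Y$1, 2 * \<sigma>^2 * w$2 * Y$2, 3 * \<sigma>^3 * (w$2)^2 * Y$2]"
proof -
  have line: "((\<lambda>s. flipped_model \<sigma> (w + s *\<^sub>R Y)) has_vector_derivative
      vector [Y$1, 2 * \<sigma>^2 * w$2 * Y$2, 3 * \<sigma>^3 * (w$2)^2 * Y$2]) (at 0)"
    unfolding flipped_model_def cuspidal_edge_model_def flip_def
    by simp (rule has_vector_derivative_vec3;
        auto intro!: derivative_eq_intros simp: power2_eq_square power3_eq_cube)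
  have "((\<lambda>s. w + s *\<^sub>R Y) has_vector_derivative Y) (at 0)"
    by (auto intro!: derivative_eq_intros)
  from vector_derivative_diff_chain_within[OF this has_derivative_at_withinI[OF
        smooth_on_has_derivative[OF smooth_flipped_model[of \<sigma>] open_UNIV UNIV_I]]]
  have "((\<lambda>s. flipped_model \<sigma> (w + s *\<^sub>R Y)) has_vector_derivative
      frechet_derivative (flipped_model \<sigma>) (at w) Y) (at 0)" by (simp add: o_def)
  then show ?thesis using line vector_derivative_unique_at by blast
qed

text \<open>For \<open>f = \<Psi> \<circ> g \<circ> \<phi>\<close> with \<open>g\<close> the model, the chart \<open>\<phi>\<^sup>-\<^sup>1\<close>, reflected if it reverses the
  orientation, is adapted.\<close>

lemma cuspidal_edge_adapted_chart:
  assumes \<Sigma>: "open \<Sigma>" and f: "smooth_on \<Sigma> f" and edge: "cuspidal_edge \<Sigma> f p"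
  obtains V x Z \<Psi> \<sigma> where "adapted_coordinates \<Sigma> f p V x" "open Z" "smooth_on Z \<Psi>"
    "\<And>z Y. z \<in> Z \<Longrightarrow> frechet_derivative \<Psi> (at z) Y = 0 \<Longrightarrow> Y = 0"
    "\<And>w. w \<in> V \<Longrightarrow> f (x w) = \<Psi> (flipped_model \<sigma> w)" "\<sigma> * \<sigma> = 1" "flipped_model \<sigma> ` V \<subseteq> Z"
proof -
  have edge': "A_equivalent \<Sigma> UNIV f p UNIV UNIV cuspidal_edge_model 0"
    using edge unfolding cuspidal_edge_def cuspidal_edge_model_def[abs_def] by simp
  obtain U V0 W Z \<phi> \<psi> \<Phi> \<Psi> where U: "open U" "U \<subseteq> \<Sigma>" "p \<in> U" and V0: "open V0" "0 \<in> V0"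
    and \<phi>: "homeomorphism U V0 \<phi> \<psi>" "smooth_on U \<phi>" "smooth_on V0 \<psi>" "\<phi> p = 0"
    and Z: "open Z" and \<Phi>: "homeomorphism W Z \<Phi> \<Psi>" "smooth_on W \<Phi>" "smooth_on Z \<Psi>"
    and im: "cuspidal_edge_model ` V0 \<subseteq> Z" and nf: "\<And>q. q \<in> U \<Longrightarrow> f q = \<Psi> (cuspidal_edge_model (\<phi> q))"
    using A_equivalent_normal_form[OF edge' \<Sigma>] by metis
  have \<Psi>inj: "Y = 0" if "z \<in> Z" "frechet_derivative \<Psi> (at z) Y = 0" for z Y
    by (rule smooth_left_inverse_derivative_inj[OF \<Phi>(3) Z \<Phi>(2) _ _ that])
      (use \<Phi>(1) in \<open>auto simp: homeomorphism_def\<close>)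
  have \<psi>inj: "Y = 0" if "w \<in> V0" "frechet_derivative \<psi> (at w) Y = 0" for w Y
    by (rule smooth_left_inverse_derivative_inj[OF \<phi>(3) V0(1) \<phi>(2) _ _ that])
      (use \<phi>(1) in \<open>auto simp: homeomorphism_def\<close>)
  have \<psi>U: "\<psi> w \<in> U" "\<phi> (\<psi> w) = w" if "w \<in> V0" for w
    using \<phi>(1) that unfolding homeomorphism_def by blast+
  note \<psi>plane = frechet_derivative_plane[OF smooth_on_linear_derivative[OF \<phi>(3) V0(1)]]
  define J where "J w = pd 1 \<psi> w $ 1 * pd 2 \<psi> w $ 2 - pd 1 \<psi> w $ 2 * pd 2 \<psi> w $ 1" for w
  have J0: "J 0 \<noteq> 0"
  proof
    assume "J 0 = 0"
    moreover have "pd 1 \<psi> 0 \<noteq> 0"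
      using \<psi>inj[OF V0(2), of "axis 1 1"] unfolding pd_def by (auto simp: axis_eq_0_iff)
    ultimately obtain k where k: "pd 2 \<psi> 0 = k *\<^sub>R pd 1 \<psi> 0"
      using plane_parallel[of "pd 1 \<psi> 0" "pd 2 \<psi> 0"] unfolding J_def by blast
    have "frechet_derivative \<psi> (at 0) (vector [k, -1]) = 0"
      unfolding \<psi>plane[OF V0(2)] k by simp
    from \<psi>inj[OF V0(2) this] show False by (simp add: vec_eq_iff forall_2)
  qed
  define \<sigma> where "\<sigma> = sgn (J 0)"
  have \<sigma>: "\<sigma> * \<sigma> = 1" "\<sigma> * J 0 > 0" using J0 by (auto simp: \<sigma>_def sgn_if)
  then have \<sigma>0: "\<sigma> \<noteq> 0" by auto
  note bl = bounded_linear_flip[of \<sigma>]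
  have cR: "continuous_on S (flip \<sigma>)" for S using bl by (rule linear_continuous_on)
  define V1 where "V1 = flip \<sigma> -` V0"
  have oV1: "open V1" unfolding V1_def using continuous_open_preimage[OF cR open_UNIV V0(1)] by simp
  have f0: "flip \<sigma> 0 = 0" by (simp add: flip_def vec_eq_iff forall_2)
  have sJ: "smooth_on V0 J" unfolding J_def[abs_def] diff_conv_add_uminus
    by (intro smooth_on_add smooth_on_mult smooth_on_component smooth_on_pd \<phi>(3) V0(1)
        smooth_on_bounded_linear[OF bounded_linear_minus[OF bounded_linear_ident]])
  have sJR: "smooth_on V1 (\<lambda>w. \<sigma> * J (flip \<sigma> w))"
    by (intro smooth_on_mult[OF oV1] smooth_on_const smooth_on_compose[OF smooth_on_linear[OF bl] sJ])
      (auto simp: V1_def)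
  define V where "V = V1 \<inter> (\<lambda>w. \<sigma> * J (flip \<sigma> w)) -` {0<..}"
  have V: "open V" "0 \<in> V" "V \<subseteq> V1"
    unfolding V_def using continuous_open_preimage[OF smooth_on_imp_continuous_on[OF sJR oV1] oV1] V0 \<sigma> f0
    by (auto simp: V1_def)
  have fV: "flip \<sigma> w \<in> V0" if "w \<in> V" for w using V(3) that by (auto simp: V1_def)
  define x where "x w = \<psi> (flip \<sigma> w)" for w
  have xU: "x w \<in> U" and \<phi>x: "flip \<sigma> (\<phi> (x w)) = w" if "w \<in> V" for w
    using \<psi>U[OF fV[OF that]] flip_flip[OF \<sigma>(1)] by (simp_all add: x_def)
  have sx: "smooth_on V x" unfolding x_def[abs_def]
    by (rule smooth_on_compose[OF smooth_on_linear[OF bl] \<phi>(3)]) (use fV in auto)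
  have inj: "inj_on x V" by (rule inj_on_inverseI[of V "\<lambda>q. flip \<sigma> (\<phi> q)"]) (rule \<phi>x)
  have oxV: "open (x ` V)"
    by (rule invariance_of_domain[OF smooth_on_imp_continuous_on[OF sx V(1)] V(1) inj])
  have xVU: "x ` V \<subseteq> U" using xU by blast
  have s\<xi>: "smooth_on (x ` V) (\<lambda>q. flip \<sigma> (\<phi> q))"
    by (rule smooth_on_bounded_linear[OF bl smooth_on_subset[OF \<phi>(2) xVU]])
  have "homeomorphism V (x ` V) x (\<lambda>q. flip \<sigma> (\<phi> q))"
    by (rule homeomorphismI)
      (use \<phi>x smooth_on_imp_continuous_on[OF sx V(1)] smooth_on_imp_continuous_on[OF s\<xi> oxV] in auto)
  then have dx: "diffeo_between V (x ` V) x" unfolding diffeo_between_def using sx s\<xi> by blast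
  have Dx: "frechet_derivative x (at w) Y = frechet_derivative \<psi> (at (flip \<sigma> w)) (flip \<sigma> Y)" if "w \<in> V" for w Y
  proof -
    have "((\<lambda>w. \<psi> (flip \<sigma> w)) has_derivative (\<lambda>Y. frechet_derivative \<psi> (at (flip \<sigma> w)) (flip \<sigma> Y))) (at w)"
      by (rule has_derivative_compose[OF bounded_linear_imp_has_derivative[OF bl]
            smooth_on_has_derivative[OF \<phi>(3) V0(1) fV[OF that]]])
    from frechet_derivative_at[OF this] show ?thesis unfolding x_def[abs_def] by metis
  qed
  have flip_axis: "flip \<sigma> (axis 1 1) = axis 1 1" "flip \<sigma> (axis 2 1) = \<sigma> *\<^sub>R axis 2 1"
    by (simp_all add: flip_def vec_eq_iff forall_2 axis_def)
  have pdx: "pd 1 x w = pd 1 \<psi> (flip \<sigma> w)" "pd 2 x w = \<sigma> *\<^sub>R pd 2 \<psi> (flip \<sigma> w)" if "w \<in> V" for w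
    unfolding pd_def Dx[OF that] flip_axis
    by (simp_all add: linear_scale[OF smooth_on_linear_derivative[OF \<phi>(3) V0(1) fV[OF that]]])
  have detJ: "det (jacobian x (at w)) = \<sigma> * J (flip \<sigma> w)" if "w \<in> V" for w
    unfolding det_jacobian_plane pdx[OF that] J_def by (simp add: algebra_simps)
  have det: "det (jacobian x (at w)) > 0" if "w \<in> V" for w
    using that detJ[OF that] by (simp add: V_def)
  have F: "f (x w) = \<Psi> (flipped_model \<sigma> w)" if "w \<in> V" for w
    using nf[OF xU[OF that]] \<psi>U[OF fV[OF that]] by (simp add: flipped_model_def x_def)
  have imV: "flipped_model \<sigma> ` V \<subseteq> Z" using im fV by (auto simp: flipped_model_def)
  have sfx: "smooth_on V (\<lambda>w. f (x w))"
    by (rule smooth_on_compose[OF sx f]) (use xU U(2) in auto)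
  have DF: "frechet_derivative (\<lambda>w. f (x w)) (at w) Y =
      frechet_derivative \<Psi> (at (flipped_model \<sigma> w)) (frechet_derivative (flipped_model \<sigma>) (at w) Y)"
    if "w \<in> V" for w Y
  proof -
    have z: "flipped_model \<sigma> w \<in> Z" using imV that by blast
    have "(\<lambda>w. f (x w)) differentiable (at w)"
      using smooth_on_has_derivative[OF sfx V(1) that] by (auto simp: differentiable_def)
    from frechet_derivative_transform_within_open[OF this V(1) that F]
    show ?thesis using smooth_on_chain[OF smooth_flipped_model[of \<sigma>] open_UNIV \<Phi>(3) Z UNIV_I z, of Y] by simp
  qed
  have xS: "x w \<in> \<Sigma>" if "w \<in> V" for w using xU[OF that] U(2) by blast
  note DFx = smooth_on_chain[OF sx V(1) f \<Sigma> _ xS]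
  have sing: "x w \<in> singular_set \<Sigma> f \<longleftrightarrow> w$2 = 0" if w: "w \<in> V" for w
  proof
    assume "x w \<in> singular_set \<Sigma> f"
    then obtain X where X: "X \<noteq> 0" "frechet_derivative f (at (x w)) X = 0"
      using singular_set_iff[OF f \<Sigma>] by blast
    have "pd 1 x w $ 1 * pd 2 x w $ 2 - pd 1 x w $ 2 * pd 2 x w $ 1 \<noteq> 0"
      using det[OF w] unfolding det_jacobian_plane by simp
    then obtain a b where ab: "X = a *\<^sub>R pd 1 x w + b *\<^sub>R pd 2 x w" using plane_basis by metis
    define Y where "Y = (vector [a, b] :: real^2)"
    have XY: "X = frechet_derivative x (at w) Y"
      unfolding frechet_derivative_plane[OF smooth_on_linear_derivative[OF sx V(1) w]] ab Y_def by simp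
    have z: "flipped_model \<sigma> w \<in> Z" using imV w by blast
    have "frechet_derivative \<Psi> (at (flipped_model \<sigma> w)) (frechet_derivative (flipped_model \<sigma>) (at w) Y) = 0"
      using X(2) unfolding XY DFx[OF w w, symmetric] DF[OF w] .
    from \<Psi>inj[OF z this] have "Y$1 = 0" "w$2 * Y$2 = 0"
      using \<sigma>0 unfolding flipped_model_derivative by (auto simp: vec_eq_iff forall_3)
    moreover have "Y \<noteq> 0"
      using X(1) linear_0[OF smooth_on_linear_derivative[OF sx V(1) w]] unfolding XY by auto
    ultimately show "w$2 = 0" by (auto simp: vec_eq_iff forall_2)
  next
    assume w2: "w$2 = 0"
    have "frechet_derivative (flipped_model \<sigma>) (at w) (axis 2 1) = 0"
      unfolding flipped_model_derivative using w2 by (simp add: vec_eq_iff forall_3 axis_def)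
    then have "frechet_derivative f (at (x w)) (frechet_derivative x (at w) (axis 2 1)) = 0"
      unfolding DFx[OF w w, symmetric] DF[OF w]
      using linear_0[OF smooth_on_linear_derivative[OF \<Phi>(3) Z, of "flipped_model \<sigma> w"]] imV w by auto
    moreover have "frechet_derivative x (at w) (axis 2 1) \<noteq> 0"
      using det[OF w] unfolding det_jacobian_plane pd_def by auto
    ultimately show "x w \<in> singular_set \<Sigma> f"
      unfolding singular_set_iff[OF f \<Sigma>] using xS[OF w] by blast
  qed
  have null: "pd 2 (f \<circ> x) w = 0" if w: "w \<in> V" and w2: "w$2 = 0" for w
  proof -
    have "frechet_derivative (flipped_model \<sigma>) (at w) (axis 2 1) = 0"
      unfolding flipped_model_derivative using w2 by (simp add: vec_eq_iff forall_3 axis_def)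
    then show ?thesis unfolding pd_def o_def DF[OF w]
      using linear_0[OF smooth_on_linear_derivative[OF \<Phi>(3) Z, of "flipped_model \<sigma> w"]] imV w by auto
  qed
  have "x 0 = p" using \<phi>(1,4) U(3) unfolding x_def f0 homeomorphism_def by auto
  then have "adapted_coordinates \<Sigma> f p V x"
    unfolding adapted_coordinates_def using V(1,2) oxV xVU U(2) dx det sing null
    by (intro conjI ballI impI order.trans[OF xVU U(2)])
  then show ?thesis by (rule that[OF _ Z \<Phi>(3) \<Psi>inj F \<sigma>(1) imV])
qed

lemma adapted_coordinatesD:
  assumes "adapted_coordinates \<Sigma> f p V x"
  shows "open V" "0 \<in> V" "x 0 = p" "open (x ` V)" "x ` V \<subseteq> \<Sigma>" "smooth_on V x"
    "w \<in> V \<Longrightarrow> det (jacobian x (at w)) > 0" "w \<in> V \<Longrightarrow> x w \<in> singular_set \<Sigma> f \<longleftrightarrow> w$2 = 0"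
    "w \<in> V \<Longrightarrow> w$2 = 0 \<Longrightarrow> pd 2 (f \<circ> x) w = 0"
proof -
  note a = assms[unfolded adapted_coordinates_def]
  show "open V" "0 \<in> V" "x 0 = p" "open (x ` V)" "x ` V \<subseteq> \<Sigma>" using a by simp_all
  have "diffeo_between V (x ` V) x" using a by simp
  then show "smooth_on V x" by (rule diffeo_betweenE)
qed (use assms in \<open>simp_all add: adapted_coordinates_def\<close>)

context front_with_gauss_map
begin

lemma area_density_chart:
  assumes x: "smooth_on V x" "open V" and w: "w \<in> V" "x w \<in> \<Sigma>"
  shows "area_density (f \<circ> x) (\<nu> \<circ> x) w = det (jacobian x (at w)) * area_density f \<nu> (x w)"
proof -
  have "pd i (f \<circ> x) w = pd i x w $ 1 *\<^sub>R pd 1 f (x w) + pd i x w $ 2 *\<^sub>R pd 2 f (x w)" for i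
    using trans[OF smooth_on_chain[OF x smooth_f open_domain w, of "axis i 1"] Df_plane[OF w(2)]]
    unfolding o_def pd_def[of i] .
  then show ?thesis
    unfolding area_density_def det_jacobian_plane by (simp add: det3_expand algebra_simps)
qed

text \<open>Since \<open>\<lambda>\<close> vanishes at \<open>p\<close>, only its own derivative survives in the product with the Jacobian
  determinant.\<close>

lemma pd2_area_density_chart:
  assumes "adapted_coordinates \<Sigma> f p V x"
  shows "pd 2 (area_density (f \<circ> x) (\<nu> \<circ> x)) 0 =
    det (jacobian x (at 0)) * frechet_derivative (area_density f \<nu>) (at p) (pd 2 x 0)"
proof -
  note a = adapted_coordinatesD[OF assms]
  have xS: "x w \<in> \<Sigma>" if "w \<in> V" for w using a(5) that by blast
  have p: "p \<in> singular_set \<Sigma> f" using a(8)[OF a(2)] a(3) by simp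
  define d where "d w = det (jacobian x (at w))" for w
  have "smooth_on V d" unfolding d_def[abs_def] det_jacobian_plane diff_conv_add_uminus
    by (intro smooth_on_add smooth_on_mult smooth_on_component smooth_on_pd a
        smooth_on_bounded_linear[OF bounded_linear_minus[OF bounded_linear_ident]])
  note dd = smooth_on_has_derivative[OF this a(1,2)]
  have dl: "((\<lambda>w. area_density f \<nu> (x w)) has_derivative
      (\<lambda>X. frechet_derivative (area_density f \<nu>) (at p) (frechet_derivative x (at 0) X))) (at 0)"
    using has_derivative_compose[OF smooth_on_has_derivative[OF a(6,1,2)]
      smooth_on_has_derivative[OF smooth_area_density open_domain xS[OF a(2)]]] unfolding a(3) .
  have "((\<lambda>w. d w * area_density f \<nu> (x w)) has_derivative
     (\<lambda>X. d 0 * frechet_derivative (area_density f \<nu>) (at p) (frechet_derivative x (at 0) X))) (at 0)"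
    by (rule has_derivative_eq_rhs[OF has_derivative_mult[OF dd dl]])
      (simp add: a(3) area_density_singular[OF p])
  then have "((area_density (f \<circ> x) (\<nu> \<circ> x)) has_derivative
     (\<lambda>X. d 0 * frechet_derivative (area_density f \<nu>) (at p) (frechet_derivative x (at 0) X))) (at 0)"
    by (rule has_derivative_transform_within_open[OF _ a(1,2)])
      (simp add: area_density_chart[OF a(6,1) _ xS] d_def)
  from frechet_derivative_at[OF this] show ?thesis unfolding pd_def d_def by metis
qed

text \<open>In the adapted chart of the normal form, \<open>F\<^sub>v = 0\<close> at the origin, so \<open>\<lambda>\<^sub>v = det(F\<^sub>u, F\<^sub>v\<^sub>v, \<nu>)\<close>;
  here \<open>F\<^sub>u\<close> and \<open>F\<^sub>v\<^sub>v\<close> are the images of \<open>(1,0,0)\<close> and \<open>(0,2,0)\<close> under \<open>d\<Psi>\<close>, and both are tangent.\<close>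

lemma area_density_nondegenerate:
  assumes edge: "cuspidal_edge \<Sigma> f p"
  shows "\<exists>X. frechet_derivative (area_density f \<nu>) (at p) X \<noteq> 0"
proof -
  obtain V x Z \<Psi> \<sigma> where ad: "adapted_coordinates \<Sigma> f p V x" and Z: "open Z" and \<Psi>: "smooth_on Z \<Psi>"
    and \<Psi>inj: "\<And>z Y. z \<in> Z \<Longrightarrow> frechet_derivative \<Psi> (at z) Y = 0 \<Longrightarrow> Y = 0"
    and F: "\<And>w. w \<in> V \<Longrightarrow> f (x w) = \<Psi> (flipped_model \<sigma> w)" and \<sigma>: "\<sigma> * \<sigma> = 1"
    and imV: "flipped_model \<sigma> ` V \<subseteq> Z"
    using cuspidal_edge_adapted_chart[OF open_domain smooth_f edge] by blast
  note a = adapted_coordinatesD[OF ad]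
  have xS: "x ` V \<subseteq> \<Sigma>" by (rule a(5))
  define G where "G = f \<circ> x"
  define N where "N = \<nu> \<circ> x"
  have sG: "smooth_on V G" unfolding G_def o_def by (rule smooth_on_compose[OF a(6) smooth_f xS])
  have sN: "smooth_on V N" unfolding N_def o_def by (rule smooth_on_compose[OF a(6) smooth_\<nu> xS])
  note sG1 = smooth_on_pd[OF sG a(1)] and dN = smooth_on_has_derivative[OF sN a(1,2)]
  note dG1 = smooth_on_has_derivative[OF sG1 a(1,2)]
  have G2: "pd 2 G 0 = 0" unfolding G_def by (rule a(9)[OF a(2)]) simp
  have tangent: "pd i G w \<bullet> N w = 0" if "w \<in> V" for i w
    using smooth_on_chain[OF a(6,1) smooth_f open_domain that, of "axis i 1"] Df_normal[of "x w"] xS that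
    by (auto simp: G_def N_def pd_def o_def)
  have "((\<lambda>w. pd 2 G w \<bullet> N w) has_derivative (\<lambda>X. 0)) (at 0)"
    by (rule has_derivative_transform_within_open[OF has_derivative_const[of 0] a(1,2)]) (simp add: tangent)
  from fun_cong[OF has_derivative_unique[OF this has_derivative_inner[OF dG1 dN]], of "axis 2 1"]
  have G22N: "pd 2 (pd 2 G) 0 \<bullet> N 0 = 0" using G2 unfolding pd_def[of 2 "pd 2 G"] by simp
  have "((\<lambda>w. det3 (pd 1 G w) (pd 2 G w) (N w)) has_derivative
      (\<lambda>X. det3 (pd 1 G 0) (frechet_derivative (pd 2 G) (at 0) X) (N 0))) (at 0)"
    unfolding det3_cross
    by (rule has_derivative_eq_rhs[OF has_derivative_inner[OF dG1
            bounded_bilinear.FDERIV[OF bounded_bilinear_cross3 dG1 dN]]]) (simp add: G2)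
  from fun_cong[OF frechet_derivative_at[OF this, symmetric], of "axis 2 1"]
  have l: "pd 2 (area_density G N) 0 = det3 (pd 1 G 0) (pd 2 (pd 2 G) 0) (N 0)"
    unfolding pd_def[of _ "area_density G N"] pd_def[of _ "pd 2 G"] unfolding area_density_def[abs_def] .
  have h0: "flipped_model \<sigma> 0 = 0"
    by (simp add: flipped_model_def cuspidal_edge_model_def flip_def vec_eq_iff forall_3)
  have zZ: "0 \<in> Z" using imV a(2) h0 by force
  have G1: "pd 1 G 0 = frechet_derivative \<Psi> (at 0) (vector [1, 0, 0])"
  proof -
    have "G differentiable (at 0)"
      using smooth_on_has_derivative[OF sG a(1,2)] by (auto simp: differentiable_def)
    from frechet_derivative_transform_within_open[OF this a(1,2), of "\<lambda>w. \<Psi> (flipped_model \<sigma> w)"]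
    have "pd 1 G 0 = frechet_derivative (\<lambda>w. \<Psi> (flipped_model \<sigma> w)) (at 0) (axis 1 1)"
      unfolding pd_def by (simp add: G_def F)
    also have "\<dots> = frechet_derivative \<Psi> (at 0) (frechet_derivative (flipped_model \<sigma>) (at 0) (axis 1 1))"
      using smooth_on_chain[OF smooth_flipped_model[of \<sigma>] open_UNIV \<Psi> Z UNIV_I, of 0] zZ by (simp add: h0)
    also have "frechet_derivative (flipped_model \<sigma>) (at 0) (axis 1 1) = vector [1, 0, 0]"
      unfolding flipped_model_derivative by (simp add: vec_eq_iff forall_3 axis_def)
    finally show ?thesis .
  qed
  define S where "S = (\<lambda>s. s *\<^sub>R (axis 2 1 :: real^2)) -` V"
  have S: "open S" "0 \<in> S"
  proof -
    have "continuous_on UNIV (\<lambda>s. s *\<^sub>R (axis 2 1 :: real^2))" by (intro continuous_intros)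
    from continuous_open_preimage[OF this open_UNIV a(1)] show "open S" unfolding S_def by simp
  qed (simp add: S_def a(2))
  define k where "k s = flipped_model \<sigma> (s *\<^sub>R axis 2 1)" for s
  have k: "k s = vector [0, s\<^sup>2, \<sigma> * s^3]" for s
    using \<sigma> by (simp add: k_def flipped_model_def cuspidal_edge_model_def flip_def vec_eq_iff forall_3 axis_def
        power_mult_distrib power2_eq_square power3_eq_cube)
  have sk: "smooth_on S k" unfolding k_def[abs_def]
    by (rule smooth_on_compose[OF smooth_on_linear[OF bounded_linear_scaleR_left] smooth_flipped_model]) simp
  have k0: "k 0 = 0" by (simp add: k vec_eq_iff forall_3)
  have dk: "(k has_vector_derivative vector [0, 2 * s, 3 * \<sigma> * s\<^sup>2]) (at s)" for s
    unfolding k[abs_def] by (intro has_vector_derivative_vec3) (auto intro!: derivative_eq_intros)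
  then have k1: "vector_derivative k (at s) = vector [0, 2 * s, 3 * \<sigma> * s\<^sup>2]" for s
    by (rule vector_derivative_at)
  have "((\<lambda>s. vector [0, 2 * s, 3 * \<sigma> * s\<^sup>2] :: real^3) has_vector_derivative vector [0, 2, 0]) (at 0)"
    by (intro has_vector_derivative_vec3) (auto intro!: derivative_eq_intros)
  then have k2: "vector_derivative (\<lambda>s. vector_derivative k (at s)) (at 0) = vector [0, 2, 0]"
    unfolding k1 by (rule vector_derivative_at)
  have kZ: "k ` S \<subseteq> Z" using imV by (auto simp: k_def S_def)
  have k10: "vector_derivative k (at 0) = 0" by (simp add: k1 vec_eq_iff forall_3)
  have g1: "vector_derivative (\<lambda>s. \<Psi> (k s)) (at s) = pd 2 G (s *\<^sub>R axis 2 1)" if "s \<in> S" for s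
  proof -
    have "vector_derivative (\<lambda>s. \<Psi> (k s)) (at s) = vector_derivative (\<lambda>s. G (s *\<^sub>R axis 2 1)) (at s)"
      by (rule vector_derivative_cong_open[OF S(1) that]) (simp add: G_def F k_def S_def)
    also have "\<dots> = pd 2 G (s *\<^sub>R axis 2 1)"
      by (rule vector_derivative_at[OF pd_along_axis[OF sG a(1)]]) (use that in \<open>simp add: S_def\<close>)
    finally show ?thesis .
  qed
  have "frechet_derivative \<Psi> (at 0) (vector [0, 2, 0]) =
      vector_derivative (\<lambda>s. vector_derivative (\<lambda>s. \<Psi> (k s)) (at s)) (at 0)"
    using second_derivative_at_stationary_point(2)[OF sk S(1) \<Psi> Z kZ S(2) k10] k2 k0 by simp
  also have "\<dots> = vector_derivative (\<lambda>s. pd 2 G (s *\<^sub>R axis 2 1)) (at 0)"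
    by (rule vector_derivative_cong_open[OF S g1])
  also have "\<dots> = pd 2 (pd 2 G) 0"
    using vector_derivative_at[OF pd_along_axis[OF sG1 a(1), of 0 2]] a(2) by simp
  finally have G22: "pd 2 (pd 2 G) 0 = frechet_derivative \<Psi> (at 0) (vector [0, 2, 0])" by simp
  have "det3 (pd 1 G 0) (pd 2 (pd 2 G) 0) (N 0) \<noteq> 0"
  proof
    assume d0: "det3 (pd 1 G 0) (pd 2 (pd 2 G) 0) (N 0) = 0"
    have "N 0 \<bullet> N 0 = 1" using \<nu>_unit[of "x 0"] xS a(2) by (auto simp: N_def)
    from det3_eq_0_imp_dependent[OF this tangent[OF a(2)] G22N d0]
    obtain X :: "real^2" where X: "X \<noteq> 0" "X$1 *\<^sub>R pd 1 G 0 + X$2 *\<^sub>R pd 2 (pd 2 G) 0 = 0" by blast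
    note lin = smooth_on_linear_derivative[OF \<Psi> Z zZ]
    have "frechet_derivative \<Psi> (at 0) (X$1 *\<^sub>R vector [1, 0, 0] + X$2 *\<^sub>R vector [0, 2, 0]) = 0"
      using X(2) unfolding G1 G22 by (simp add: linear_add[OF lin] linear_scale[OF lin])
    from \<Psi>inj[OF zZ this] have "X = 0" by (simp add: vec_eq_iff forall_2 forall_3)
    then show False using X(1) by blast
  qed
  then have "det (jacobian x (at 0)) * frechet_derivative (area_density f \<nu>) (at p) (pd 2 x 0) \<noteq> 0"
    using l pd2_area_density_chart[OF ad] unfolding G_def N_def by simp
  then show ?thesis by auto
qed

end


section \<open>Signs along the singular curve\<close>

lemma rot90_components: "rot90 v $ 1 = - v$2" "rot90 v $ 2 = v$1"
  by (simp_all add: rot90_def)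

lemma rot90_frame_det: "v$1 * rot90 v $ 2 - v$2 * rot90 v $ 1 = v \<bullet> v" for v :: "real^2"
  by (simp add: rot90_components inner_vec_def sum_2)

context front_with_gauss_map
begin

text \<open>\<open>d\<lambda>\<close> is non-zero at \<open>p\<close> and vanishes along the singular curve, so the derivative to the left,
  where \<open>\<lambda>\<close> is positive, cannot be zero.\<close>

lemma area_density_derivative_left:
  assumes \<gamma>: "0 < \<epsilon>" "smooth_on {-\<epsilon><..<\<epsilon>} \<gamma>" "\<gamma> 0 = p" "vector_derivative \<gamma> (at 0) \<noteq> 0"
    "\<And>t. t \<in> {-\<epsilon><..<\<epsilon>} \<Longrightarrow> \<gamma> t \<in> singular_set \<Sigma> f"
    and edge: "cuspidal_edge \<Sigma> f p"
    and pos: "\<forall>\<^sub>F s in at_right 0. area_density f \<nu> (p + s *\<^sub>R rot90 (vector_derivative \<gamma> (at 0))) > 0"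
  shows "frechet_derivative (area_density f \<nu>) (at p) (vector_derivative \<gamma> (at 0)) = 0"
    and "frechet_derivative (area_density f \<nu>) (at p) (rot90 (vector_derivative \<gamma> (at 0))) > 0"
proof -
  let ?I = "{-\<epsilon><..<\<epsilon>}" and ?D = "frechet_derivative (area_density f \<nu>) (at p)"
  let ?v = "vector_derivative \<gamma> (at 0)"
  have I: "open ?I" "0 \<in> ?I" using \<gamma>(1) by auto
  have psing: "p \<in> singular_set \<Sigma> f" using \<gamma>(5)[OF I(2)] \<gamma>(3) by simp
  then have p: "p \<in> \<Sigma>" by (simp add: singular_set_def)
  note lin = smooth_on_linear_derivative[OF smooth_area_density open_domain p]
  have "((\<lambda>t. area_density f \<nu> (\<gamma> t)) has_vector_derivative 0) (at 0)"
    by (rule has_vector_derivative_transform_within_open[OF has_vector_derivative_const[of 0] I])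
      (simp add: area_density_singular \<gamma>(5))
  moreover have "((\<lambda>t. area_density f \<nu> (\<gamma> t)) has_vector_derivative ?D ?v) (at 0)"
    using smooth_on_chain_curve[OF \<gamma>(2) I(1) smooth_area_density open_domain I(2)] p \<gamma>(3) by simp
  ultimately show 0: "?D ?v = 0" using vector_derivative_unique_at by blast
  let ?w = "rot90 ?v"
  have "((\<lambda>s. p + s *\<^sub>R ?w) has_vector_derivative ?w) (at 0)"
    by (auto intro!: derivative_eq_intros)
  moreover have "(area_density f \<nu> has_derivative ?D) (at (p + 0 *\<^sub>R ?w))"
    using smooth_on_has_derivative[OF smooth_area_density open_domain p] by simp
  ultimately have d: "((\<lambda>s. area_density f \<nu> (p + s *\<^sub>R ?w)) has_real_derivative ?D ?w) (at 0)"
    unfolding has_real_derivative_iff_has_vector_derivative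
    by (rule vector_derivative_diff_chain_within[OF _ has_derivative_at_withinI, unfolded o_def])
  have "\<not> ?D ?w < 0"
  proof
    assume "?D ?w < 0"
    from DERIV_neg_dec_right[OF d this] obtain e where e: "e > 0"
      "\<And>h. 0 < h \<Longrightarrow> h < e \<Longrightarrow> area_density f \<nu> (p + h *\<^sub>R ?w) < area_density f \<nu> p" by auto
    obtain b where b: "b > 0" "\<And>s. 0 < s \<Longrightarrow> s < b \<Longrightarrow> area_density f \<nu> (p + s *\<^sub>R ?w) > 0"
      using pos unfolding eventually_at_right_field by auto
    define h where "h = min e b / 2"
    have "0 < h" "h < e" "h < b" using e(1) b(1) by (auto simp: h_def min_def)
    then show False using e(2)[of h] b(2)[of h] area_density_singular[OF psing] by simp
  qed
  moreover have "?D ?w \<noteq> 0"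
  proof
    assume w0: "?D ?w = 0"
    have *: "?v$1 * ?w$2 - ?v$2 * ?w$1 \<noteq> 0" unfolding rot90_frame_det using \<gamma>(4) by simp
    have "?D X = 0" for X
    proof -
      obtain r b where "X = r *\<^sub>R ?v + b *\<^sub>R ?w" by (rule plane_basis[OF *])
      then show ?thesis using 0 w0 by (simp add: linear_add[OF lin] linear_scale[OF lin])
    qed
    then show False using area_density_nondegenerate[OF edge] by blast
  qed
  ultimately show "?D ?w > 0" by simp
qed

text \<open>In an adapted chart \<open>x\<close> the singular curve is \<open>\<gamma>(t) = x(u(t), 0)\<close>. Both \<open>sgn \<lambda>\<^sub>v\<close> and the cube
  \<open>u'\<^sup>3\<close>, by which the triple products along \<open>\<gamma>\<close> and along the \<open>u\<close>-axis differ, carry the sign of \<open>u'\<close>.\<close>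

lemma singular_curvature_in_sign:
  assumes ad: "adapted_coordinates \<Sigma> f p V x"
    and \<gamma>: "0 < \<epsilon>" "smooth_on {-\<epsilon><..<\<epsilon>} \<gamma>" "\<gamma> 0 = p" "vector_derivative \<gamma> (at 0) \<noteq> 0"
    "\<And>t. t \<in> {-\<epsilon><..<\<epsilon>} \<Longrightarrow> \<gamma> t \<in> singular_set \<Sigma> f"
    and D0: "frechet_derivative (area_density f \<nu>) (at p) (vector_derivative \<gamma> (at 0)) = 0"
    and D1: "frechet_derivative (area_density f \<nu>) (at p) (rot90 (vector_derivative \<gamma> (at 0))) > 0"
    and g0: "vector_derivative (f \<circ> \<gamma>) (at 0) \<noteq> 0"
  shows "\<exists>m>0. singular_curvature_in f \<nu> x = m * det3 (vector_derivative (f \<circ> \<gamma>) (at 0))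
    (vector_derivative (\<lambda>t. vector_derivative (f \<circ> \<gamma>) (at t)) (at 0)) (\<nu> p)"
proof -
  let ?I = "{-\<epsilon><..<\<epsilon>}" and ?D = "frechet_derivative (area_density f \<nu>) (at p)"
  let ?v = "vector_derivative \<gamma> (at 0)"
  note a = adapted_coordinatesD[OF ad]
  have I: "open ?I" "0 \<in> ?I" using \<gamma>(1) by auto
  have "diffeo_between V (x ` V) x" using ad by (simp add: adapted_coordinates_def)
  then obtain \<xi> where \<xi>: "homeomorphism V (x ` V) x \<xi>" "smooth_on (x ` V) \<xi>" by (rule diffeo_betweenE)
  have p: "p \<in> \<Sigma>" using a(2,3,5) by blast
  define J where "J = ?I \<inter> \<gamma> -` (x ` V)"
  have J: "open J" "0 \<in> J" unfolding J_def
    using continuous_open_preimage[OF smooth_on_imp_continuous_on[OF \<gamma>(2) I(1)] I(1) a(4)] I \<gamma>(3)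
      imageI[OF a(2), of x] a(3) by simp_all
  define u where "u t = \<xi> (\<gamma> t) $ 1" for t
  have su: "smooth_on J u" unfolding u_def[abs_def]
    by (rule smooth_on_component[OF smooth_on_compose[OF smooth_on_subset[OF \<gamma>(2)] \<xi>(2)]]) (auto simp: J_def)
  have \<xi>V: "\<xi> (\<gamma> t) \<in> V" "x (\<xi> (\<gamma> t)) = \<gamma> t" if "t \<in> J" for t
    using \<xi>(1) that unfolding homeomorphism_def J_def by auto
  have \<xi>\<gamma>: "\<xi> (\<gamma> t) = u t *\<^sub>R axis 1 1" if "t \<in> J" for t
  proof -
    have "x (\<xi> (\<gamma> t)) \<in> singular_set \<Sigma> f" using \<xi>V[OF that] \<gamma>(5) that by (simp add: J_def)
    then have "\<xi> (\<gamma> t) $ 2 = 0" using a(8)[OF \<xi>V(1)[OF that]] by blast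
    then show ?thesis by (simp add: vec_eq_iff forall_2 u_def axis_def)
  qed
  have uV: "u t *\<^sub>R axis 1 1 \<in> V" and \<gamma>x: "\<gamma> t = x (u t *\<^sub>R axis 1 1)" if "t \<in> J" for t
    using \<xi>V[OF that] \<xi>\<gamma>[OF that] by simp_all
  have "\<xi> (\<gamma> 0) = 0" using \<xi>(1) a(2,3) \<gamma>(3) unfolding homeomorphism_def by auto
  then have u0: "u 0 = 0" by (simp add: u_def)
  define u' where "u' t = vector_derivative u (at t)" for t
  have du: "(u has_real_derivative u' t) (at t)" if "t \<in> J" for t
    unfolding u'_def by (rule smooth_on_real_derivative[OF su J(1) that])
  have su': "smooth_on J u'" unfolding u'_def[abs_def] by (rule smooth_on_vector_derivative[OF su J(1)])
  have du': "(u' has_real_derivative vector_derivative u' (at 0)) (at 0)"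
    by (rule smooth_on_real_derivative[OF su' J])
  have along: "((\<lambda>t. G (u t *\<^sub>R axis 1 1)) has_vector_derivative u' t *\<^sub>R pd 1 G (u t *\<^sub>R axis 1 1)) (at t)"
    if "smooth_on V G" "t \<in> J" for G :: "real^2 \<Rightarrow> 'b::euclidean_space" and t
    using vector_diff_chain_at[OF du[OF that(2), unfolded has_real_derivative_iff_has_vector_derivative]
        pd_along_axis[OF that(1) a(1) uV[OF that(2)]]] by (simp add: o_def)
  have "(\<gamma> has_vector_derivative u' 0 *\<^sub>R pd 1 x 0) (at 0)"
    using has_vector_derivative_transform_within_open[OF along[OF a(6) J(2)] J, of \<gamma>] \<gamma>x u0 by simp
  then have v: "?v = u' 0 *\<^sub>R pd 1 x 0" by (rule vector_derivative_at)
  then have u'0: "u' 0 \<noteq> 0" using \<gamma>(4) by auto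
  define F where "F = f \<circ> x"
  have sF: "smooth_on V F" unfolding F_def o_def by (rule smooth_on_compose[OF a(6) smooth_f a(5)])
  have g1: "vector_derivative (f \<circ> \<gamma>) (at t) = u' t *\<^sub>R pd 1 F (u t *\<^sub>R axis 1 1)" if "t \<in> J" for t
    by (rule vector_derivative_at,
        rule has_vector_derivative_transform_within_open[OF along[OF sF that] J(1) that])
      (simp add: F_def \<gamma>x)
  have "((\<lambda>t. u' t *\<^sub>R pd 1 F (u t *\<^sub>R axis 1 1)) has_vector_derivative
      u' 0 *\<^sub>R (u' 0 *\<^sub>R pd 1 (pd 1 F) 0) + vector_derivative u' (at 0) *\<^sub>R pd 1 F 0) (at 0)"
    using has_vector_derivative_scaleR[OF du' along[OF smooth_on_pd[OF sF a(1)] J(2)]] u0 by simp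
  then have "((\<lambda>t. vector_derivative (f \<circ> \<gamma>) (at t)) has_vector_derivative
      u' 0 *\<^sub>R (u' 0 *\<^sub>R pd 1 (pd 1 F) 0) + vector_derivative u' (at 0) *\<^sub>R pd 1 F 0) (at 0)"
    by (rule has_vector_derivative_transform_within_open[OF _ J g1[symmetric]])
  then have g2: "vector_derivative (\<lambda>t. vector_derivative (f \<circ> \<gamma>) (at t)) (at 0) =
      u' 0 *\<^sub>R (u' 0 *\<^sub>R pd 1 (pd 1 F) 0) + vector_derivative u' (at 0) *\<^sub>R pd 1 F 0"
    by (rule vector_derivative_at)
  have g10: "vector_derivative (f \<circ> \<gamma>) (at 0) = u' 0 *\<^sub>R pd 1 F 0" using g1[OF J(2)] u0 by simp
  have det: "det3 (vector_derivative (f \<circ> \<gamma>) (at 0))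
      (vector_derivative (\<lambda>t. vector_derivative (f \<circ> \<gamma>) (at t)) (at 0)) (\<nu> p) =
      u' 0 ^ 3 * det3 (pd 1 F 0) (pd 1 (pd 1 F) 0) (\<nu> p)"
    unfolding g10 g2 by (simp add: det3_expand algebra_simps power3_eq_cube)
  have F1: "pd 1 F 0 \<noteq> 0" using g0 g10 by auto
  have "?v$1 * rot90 ?v $2 - ?v$2 * rot90 ?v $1 \<noteq> 0" unfolding rot90_frame_det using \<gamma>(4) by simp
  then obtain r b where rb: "pd 2 x 0 = r *\<^sub>R ?v + b *\<^sub>R rot90 ?v"
    "b * (?v$1 * rot90 ?v $2 - ?v$2 * rot90 ?v $1) = ?v$1 * pd 2 x 0 $ 2 - ?v$2 * pd 2 x 0 $ 1"
    by (rule plane_basis)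
  have b: "b * (?v \<bullet> ?v) = u' 0 * det (jacobian x (at 0))"
    using rb(2) unfolding rot90_frame_det det_jacobian_plane by (simp add: v algebra_simps)
  have sgnb: "sgn b = sgn (u' 0)"
    using arg_cong[OF b, of sgn] a(7)[OF a(2)] \<gamma>(4) by (simp add: sgn_mult)
  note lin = smooth_on_linear_derivative[OF smooth_area_density open_domain p]
  have "pd 2 (area_density F (\<nu> \<circ> x)) 0 = det (jacobian x (at 0)) * (b * ?D (rot90 ?v))"
    unfolding F_def pd2_area_density_chart[OF ad] rb(1) linear_add[OF lin] linear_scale[OF lin] D0 by simp
  then have sgnl: "sgn (pd 2 (area_density F (\<nu> \<circ> x)) 0) = sgn (u' 0)"
    using a(7)[OF a(2)] D1 sgnb by (simp add: sgn_mult)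
  define m where "m = sgn (u' 0) / (u' 0 ^ 3 * norm (pd 1 F 0) ^ 3)"
  have "sgn (u' 0) / u' 0 ^ 3 > 0"
  proof (cases "u' 0 > 0")
    case False
    then have "u' 0 * (u' 0 * u' 0) < 0" using u'0 by (intro mult_neg_pos mult_neg_neg) auto
    then have "u' 0 ^ 3 < 0" by (simp add: power3_eq_cube)
    then show ?thesis using False u'0 by (simp add: sgn_if divide_neg_neg)
  qed simp
  then have "sgn (u' 0) / u' 0 ^ 3 / norm (pd 1 F 0) ^ 3 > 0"
    by (rule divide_pos_pos) (use F1 in simp)
  then have "m > 0" unfolding m_def by (simp only: divide_divide_eq_left)
  moreover have "singular_curvature_in f \<nu> x = m * (u' 0 ^ 3 * det3 (pd 1 F 0) (pd 1 (pd 1 F) 0) (\<nu> p))"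
    unfolding singular_curvature_in_def Let_def F_def[symmetric] sgnl m_def
    using u'0 a(3) by simp
  ultimately show ?thesis unfolding det by blast
qed

end

theorem theorem2:
  fixes \<Sigma> U :: "(real^2) set"
    and f \<nu> :: "real^2 \<Rightarrow> real^3"
    and p :: "real^2"
    and \<gamma> :: "real \<Rightarrow> real^2"
    and \<epsilon> :: real
  assumes "open \<Sigma>" and "connected \<Sigma>"
    and "front \<Sigma> f" and "is_gauss_map \<Sigma> f \<nu>"
    and "p \<in> \<Sigma>" and "cuspidal_edge \<Sigma> f p"
    and "singular_curve \<Sigma> f p \<epsilon> \<gamma>"
    and "open U" and "p \<in> U" and "U \<subseteq> \<Sigma>"
    and "positive_on_left U \<epsilon> \<gamma> (area_density f \<nu>)"
    and "bounded (gaussian_curvature f \<nu> ` (U - singular_set \<Sigma> f))"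
    and "\<forall>q\<in>U. extended_gaussian_curvature \<Sigma> f \<nu> q \<noteq> 0"
    and "gauss_map_cusp \<Sigma> \<nu> p"
  shows "(positive_cusp {-\<epsilon><..<\<epsilon>} (\<nu> \<circ> \<gamma>) 0 \<longleftrightarrow> singular_curvature \<Sigma> f \<nu> p > 0) \<and>
         (negative_cusp {-\<epsilon><..<\<epsilon>} (\<nu> \<circ> \<gamma>) 0 \<longleftrightarrow> singular_curvature \<Sigma> f \<nu> p < 0)"
proof -
  have sf: "smooth_on \<Sigma> f" using assms(3) by (simp add: front_def)
  interpret front_with_gauss_map \<Sigma> f \<nu> by unfold_locales fact+
  let ?I = "{-\<epsilon><..<\<epsilon>}" and ?v = "vector_derivative \<gamma> (at 0)"
  have \<gamma>: "0 < \<epsilon>" "smooth_on ?I \<gamma>" "\<gamma> 0 = p" "\<And>t. t \<in> ?I \<Longrightarrow> vector_derivative \<gamma> (at t) \<noteq> 0"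
    "\<And>t. t \<in> ?I \<Longrightarrow> \<gamma> t \<in> singular_set \<Sigma> f"
    using assms(7) by (auto simp: singular_curve_def cuspidal_edge_def)
  have I: "open ?I" "0 \<in> ?I" using \<gamma>(1) by auto
  have \<gamma>\<Sigma>: "\<gamma> t \<in> \<Sigma>" if "t \<in> ?I" for t using \<gamma>(5)[OF that] by (simp add: singular_set_def)
  have left: "\<forall>\<^sub>F s in at_right 0. area_density f \<nu> (\<gamma> t + s *\<^sub>R rot90 (vector_derivative \<gamma> (at t))) > 0"
    if "t \<in> ?I" "\<gamma> t \<in> U" for t
    using assms(11) that unfolding positive_on_left_def by blast
  have gd: "gauss_density (\<gamma> t) = 0" if "t \<in> ?I" "\<gamma> t \<in> U" for t
    by (rule gauss_density_singular[OF assms(8) that(2) assms(10,12) \<gamma>(5)[OF that(1)] left[OF that]])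
  have ker: "\<exists>X. X \<noteq> 0 \<and> D\<nu> (\<gamma> t) X = 0" if "t \<in> ?I" "\<gamma> t \<in> U" for t
    using gauss_density_eq_0_imp_kernel[OF \<gamma>\<Sigma>[OF that(1)] gd[OF that]] by metis
  note cusp = gauss_map_cusp_along_singular_curve[OF assms(1) smooth_\<nu> assms(14) \<gamma>(1,2,3) \<gamma>(4)[OF I(2)]
      assms(8,9) ker]
  define J where "J = ?I \<inter> \<gamma> -` U"
  have J: "open J" "0 \<in> J" "J \<subseteq> ?I" unfolding J_def
    using continuous_open_preimage[OF smooth_on_imp_continuous_on[OF \<gamma>(2) I(1)] I(1) assms(8)] I \<gamma>(3) assms(9) by auto
  have JU: "\<gamma> t \<in> U" "t \<in> ?I" if "t \<in> J" for t using that by (auto simp: J_def)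
  have d\<nu>\<gamma>: "vector_derivative (\<nu> \<circ> \<gamma>) (at t) = D\<nu> (\<gamma> t) (vector_derivative \<gamma> (at t))" if "t \<in> ?I" for t
    using vector_derivative_at[OF smooth_on_chain_curve[OF \<gamma>(2) I(1) smooth_\<nu> open_domain that \<gamma>\<Sigma>[OF that]]]
    by (simp add: o_def)
  have df\<gamma>: "vector_derivative (f \<circ> \<gamma>) (at t) = Df (\<gamma> t) (vector_derivative \<gamma> (at t))" if "t \<in> ?I" for t
    using vector_derivative_at[OF smooth_on_chain_curve[OF \<gamma>(2) I(1) smooth_f open_domain that \<gamma>\<Sigma>[OF that]]]
    by (simp add: o_def)
  \<comment> \<open>\<open>d\<nu>\<close> already annihilates \<open>\<gamma>'(0)\<close>, so the immersion \<open>(f, \<nu>)\<close> does not allow \<open>df\<close> to do so.\<close>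
  have g0: "vector_derivative (f \<circ> \<gamma>) (at 0) \<noteq> 0"
  proof
    assume 0: "vector_derivative (f \<circ> \<gamma>) (at 0) = 0"
    have "Df p ?v = 0" "D\<nu> p ?v = 0" using 0 cusp(2) df\<gamma>[OF I(2)] d\<nu>\<gamma>[OF I(2)] \<gamma>(3) by simp_all
    then show False using immersed[OF assms(5)] \<gamma>(4)[OF I(2)] by blast
  qed
  have "\<gamma> ` J \<subseteq> \<Sigma>" using \<gamma>\<Sigma> J(3) by blast
  note sJ = smooth_on_compose[OF smooth_on_subset[OF \<gamma>(2) J(3)] _ this]
  have s\<nu>\<gamma>: "smooth_on J (\<nu> \<circ> \<gamma>)" and sf\<gamma>: "smooth_on J (f \<circ> \<gamma>)"
    unfolding o_def by (rule sJ smooth_\<nu> smooth_f)+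
  obtain m where m: "m > 0" "cuspidal_curvature (\<nu> \<circ> \<gamma>) 0 = m * det3 (vector_derivative (f \<circ> \<gamma>) (at 0))
      (vector_derivative (\<lambda>t. vector_derivative (f \<circ> \<gamma>) (at t)) (at 0)) (\<nu> p)"
  proof -
    have "\<exists>m>0. cuspidal_curvature (\<nu> \<circ> \<gamma>) 0 = m * det3 (vector_derivative (f \<circ> \<gamma>) (at 0))
      (vector_derivative (\<lambda>t. vector_derivative (f \<circ> \<gamma>) (at t)) (at 0)) ((\<nu> \<circ> \<gamma>) 0)"
    proof (rule cuspidal_curvature_orthogonal_curve[OF s\<nu>\<gamma> sf\<gamma> J(1,2) _ _ _ cusp(2,3) g0])
      fix t assume t: "t \<in> J"
      show "(\<nu> \<circ> \<gamma>) t \<bullet> (\<nu> \<circ> \<gamma>) t = 1" using \<nu>_unit \<gamma>\<Sigma> JU[OF t] by simp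
      show "vector_derivative (f \<circ> \<gamma>) (at t) \<bullet> (\<nu> \<circ> \<gamma>) t = 0"
        unfolding df\<gamma>[OF JU(2)[OF t]] using Df_normal \<gamma>\<Sigma> JU[OF t] by simp
      show "vector_derivative (f \<circ> \<gamma>) (at t) \<bullet> vector_derivative (\<nu> \<circ> \<gamma>) (at t) = 0"
        unfolding df\<gamma>[OF JU(2)[OF t]] d\<nu>\<gamma>[OF JU(2)[OF t]]
        by (rule second_fundamental_form_eq_0[OF \<gamma>(5)[OF JU(2)[OF t]] gd[OF JU(2,1)[OF t]]])
    qed
    then show ?thesis using that \<gamma>(3) by auto
  qed
  \<comment> \<open>The singular curvature is evaluated in a chosen adapted chart, about which only adaptedness is known.\<close>
  have "\<exists>x V. adapted_coordinates \<Sigma> f p V x"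
    using cuspidal_edge_adapted_chart[OF assms(1) sf assms(6)] by metis
  then have "\<exists>V. adapted_coordinates \<Sigma> f p V (SOME x. \<exists>V. adapted_coordinates \<Sigma> f p V x)"
    by (rule someI_ex)
  then obtain V where ad: "adapted_coordinates \<Sigma> f p V (SOME x. \<exists>V. adapted_coordinates \<Sigma> f p V x)" ..
  note left0 = left[OF I(2), unfolded \<gamma>(3), OF assms(9)]
  note D = area_density_derivative_left[OF \<gamma>(1,2,3) \<gamma>(4)[OF I(2)] \<gamma>(5) assms(6) left0]
  obtain m' where m': "m' > 0" "singular_curvature \<Sigma> f \<nu> p = m' * det3 (vector_derivative (f \<circ> \<gamma>) (at 0))
      (vector_derivative (\<lambda>t. vector_derivative (f \<circ> \<gamma>) (at t)) (at 0)) (\<nu> p)"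
    using singular_curvature_in_sign[OF ad \<gamma>(1,2,3) \<gamma>(4)[OF I(2)] \<gamma>(5) D g0]
    unfolding singular_curvature_def by blast
  show ?thesis
    unfolding positive_cusp_def negative_cusp_def m(2) m'(2) using cusp(1) m(1) m'(1)
    by (simp add: zero_less_mult_iff mult_less_0_iff)
qed

end
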